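(* Let $k\geq 2$ be an integer and $r>-1$ a real number. For an integer $x\geq 2$ let $X_1^{(x)},\ldots,X_k^{(x)}$ be independent random variables, each uniformly distributed on $\{1,\ldots,x\}$. Then the series $C_{r,k}=\sum_{n=1}^{\infty} n^{-r}p_k(n)$ converges, and $$\mathbb{E}\left(\frac{\operatorname{lcm}(X_1^{(x)}, \ldots, X_k^{(x)})^r}{x^{kr}}\right)=\frac1{x^k} \sum_{n_1,\ldots, n_k\leq x}\left( \frac{\operatorname{lcm}(n_1,\ldots, n_k)}{x^{k}}\right)^r=\frac{C_{r,k}}{(r+1)^k}+E_{r,k}(x)$$ and $$\mathbb{E}\left(\frac{\operatorname{lcm}(X_1^{(x)}, \ldots, X_k^{(x)})^r}{(X_1^{(x)}\cdots X_k^{(x)})^r}\right)=\frac1{x^k} \sum_{n_1,\ldots, n_k\leq x} \left(\frac{\operatorname{lcm}(n_1,\ldots, n_k)}{n_1\cdots n_k}\right)^r=C_{r,k}+E^*_{r,k}(x),$$ where the sums are over positive integers $n_1,\dots,n_k\le x$, and both error terms $E_{r,k}(x)$ and $E^*_{r,k}(x)$ are $$O_r\left(x^{-\frac{r+1}2} \log^{\max(2^k-k-1,\, 2k^2-k-2)} x\right) \text{ if } -1<r\leq 1,\qquad O_r(x^{-1}\log^{k-1} x) \text{ if } r>1,$$ with implied constants depending only on $r$ and $k$.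
   Context: Definition of $p_k(n)$: for each prime $p$ let $\mathcal{G}_1(p),\ldots,\mathcal{G}_k(p)$ be random variables, all of them (over all primes $p$ and all $j\le k$) mutually independent, with $\mathbb{P}(\mathcal{G}_j(p)=m)=(1-\frac1p)p^{-m}$ for every integer $m\geq 0$. Let $R_k=\prod_{p \text{ prime}} p^{\max_{j\leq k}\mathcal{G}_j(p)-\sum_{j\leq k}\mathcal{G}_j(p)}$, which almost surely equals $1/n$ for some positive integer $n$. For a positive integer $n$, $p_k(n)=\mathbb{P}(R_k=1/n)$. *)

theory Defs
  imports "HOL-Probability.Probability"
begin

text \<open>Canonical space of the independent variables \<open>\<G>\<^sub>j(p)\<close>, where \<open>\<G>\<^sub>j(p)\<close> is the
  coordinate \<open>\<omega> (j, p)\<close>. Since \<^const>\<open>geometric_pmf\<close> takes the success probability as its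
  parameter and counts failures, \<open>\<G>\<^sub>j(p) = m\<close> has probability \<open>(1 - 1/p) p\<^sup>-\<^sup>m\<close>.\<close>

definition geom_space :: "nat \<Rightarrow> (nat \<times> nat \<Rightarrow> nat) measure" where
  "geom_space k = (\<Pi>\<^sub>M (j, p) \<in> {1..k} \<times> {p. prime p}. measure_pmf (geometric_pmf (1 - 1 / real p)))"

text \<open>For \<open>k \<ge> 1\<close>, almost surely only finitely many factors differ from \<open>1\<close>. On the remaining null
  event the partial products tend to \<open>0\<close> and \<^const>\<open>prodinf\<close> is an unspecified constant, which
  does not affect the law of \<open>R_prod k\<close>.\<close>

definition R_prod :: "nat \<Rightarrow> (nat \<times> nat \<Rightarrow> nat) \<Rightarrow> real" where
  "R_prod k \<omega> = (\<Prod>p. if prime p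
     then real p powi (int (MAX j\<in>{1..k}. \<omega> (j, p)) - int (\<Sum>j\<in>{1..k}. \<omega> (j, p))) else 1)"

definition p_coeff :: "nat \<Rightarrow> nat \<Rightarrow> real" where
  "p_coeff k n = \<P>(\<omega> in geom_space k. R_prod k \<omega> = 1 / real n)"

definition C_term :: "real \<Rightarrow> nat \<Rightarrow> nat \<Rightarrow> real" where
  "C_term r k n = real n powr (- r) * p_coeff k n"

definition C_const :: "real \<Rightarrow> nat \<Rightarrow> real" where
  "C_const r k = (\<Sum>n. C_term r k (Suc n))"

definition iid_uniform :: "'a measure \<Rightarrow> nat \<Rightarrow> nat \<Rightarrow> (nat \<Rightarrow> 'a \<Rightarrow> nat) \<Rightarrow> bool" where
  "iid_uniform M k x X \<longleftrightarrow>
     prob_space M \<and>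
     prob_space.indep_vars M (\<lambda>_. count_space UNIV) X {1..k} \<and>
     (\<forall>j\<in>{1..k}. distr M (count_space UNIV) (X j) = measure_pmf (pmf_of_set {1..x}))"

text \<open>The averages over all tuples \<open>(n\<^sub>1, \<dots>, n\<^sub>k)\<close> of positive integers at most \<open>x\<close>.\<close>

definition lcm_avg :: "real \<Rightarrow> nat \<Rightarrow> nat \<Rightarrow> real" where
  "lcm_avg r k x = 1 / real x ^ k *
     (\<Sum>n\<in>{1..k} \<rightarrow>\<^sub>E {1..x}. (real (LCM j\<in>{1..k}. n j) / real x ^ k) powr r)"

definition lcm_ratio_avg :: "real \<Rightarrow> nat \<Rightarrow> nat \<Rightarrow> real" where
  "lcm_ratio_avg r k x = 1 / real x ^ k *
     (\<Sum>n\<in>{1..k} \<rightarrow>\<^sub>E {1..x}. (real (LCM j\<in>{1..k}. n j) / real (\<Prod>j\<in>{1..k}. n j)) powr r)"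

end

theory Submission
  imports Defs
begin

text \<open>The function \<open>f(n) = (lcm(n\<^sub>1, \<dots>, n\<^sub>k) / (n\<^sub>1 \<cdots> n\<^sub>k))\<^sup>r\<close> depends multiplicatively on the
  vector of exponents at each prime, so \<open>f(n) = \<Sum> g(d)\<close> over all \<open>d\<close> with \<open>d\<^sub>j | n\<^sub>j\<close>, where \<open>g\<close> is
  a product over primes of mixed differences of the function \<open>a \<mapsto> p powr (r (max a - sum a))\<close>.
  Both averages become \<open>\<Sum> g(d) A(d\<^sub>1) \<cdots> A(d\<^sub>k)\<close>, where \<open>A(d) = (1/(\<rho>+1) + O((d/x)\<^sup>s)) / d\<close> and
  \<open>\<rho>\<close> is \<open>r\<close> or \<open>0\<close>. The key point is that a local difference vanishes unless the largest exponent is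
  attained at least twice. Hence the Euler product of \<open>\<Sum> |g(d)| d\<^sub>i\<^sup>s / (d\<^sub>1 \<cdots> d\<^sub>k)\<close> is finite for
  \<open>s = (1+r)/2\<close> if \<open>r \<le> 0\<close>, and it is \<open>O((1/(1-s))\<^sup>k\<^sup>-\<^sup>1)\<close> for \<open>s < 1\<close> if \<open>r > 0\<close>.
  The sum \<open>\<Sum> g(d) / (d\<^sub>1 \<cdots> d\<^sub>k)\<close> is the expectation of \<open>R\<^sub>k\<^sup>r\<close>, because \<open>1/(d\<^sub>1 \<cdots> d\<^sub>k)\<close> is the
  probability that the geometric exponents dominate those of \<open>d\<close>. Cutting off the primes and the
  exponents at \<open>N \<ge> x\<close> keeps all sums finite until \<open>N\<close> tends to infinity.\<close>

subsection \<open>Mixed differences\<close>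

text \<open>In a product of \<open>k\<close> means the error can be charged to one coordinate at a
  time, so a single weight \<open>d_i^s\<close> suffices. The most expensive nonzero local
  difference has exponent 1 at \<open>i\<close> and at one other coordinate. It weighs about
  \<open>p^(s-2)\<close> if \<open>r > 0\<close> and about \<open>p^(s-r-2)\<close> if
  \<open>r < 0\<close>. For negative \<open>r\<close> convergence therefore asks for
  \<open>s < 1 + r\<close>, and \<open>s = (1+r)/2\<close> keeps away from this boundary. For
  \<open>r > 0\<close> the value \<open>s = 1\<close> is just out of reach: the Euler product
  behaves like \<open>\<zeta>(2-s)^(k-1)\<close>, where \<open>k-1\<close> counts the partners of
  \<open>i\<close>, and moving \<open>s\<close> to 1 along with \<open>x\<close> costs
  \<open>log^(k-1) x\<close>. The average at \<open>x\<close> and the truncated expectation are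
  expanded with the same coefficients at the same cutoff, so they are compared term by term before
  any limit, with bounds uniform in \<open>N\<close>. For negative \<open>r\<close> the variable
  \<open>R_k^r\<close> is unbounded, and the limit then rests on monotonicity in \<open>N\<close>
  and on the same Euler product bound.\<close>

definition delta_kernel :: "nat \<Rightarrow> nat \<Rightarrow> real" where
  "delta_kernel a b = of_bool (a = b) - of_bool (a = Suc b)"

text \<open>For \<open>a\<close> in the box this is the alternating sum of \<open>\<phi>\<close>
  over the corners \<open>a - 1_S\<close>, \<open>S\<close> a subset of \<open>K\<close>, corners
  with a negative coordinate being dropped: Moebius inversion for the product order. Summing over
  the whole box against a product kernel makes exchanges of sums and factorization over the
  coordinates immediate.\<close>

definition mixed_diff :: "'i set \<Rightarrow> nat \<Rightarrow> (('i \<Rightarrow> nat) \<Rightarrow> real) \<Rightarrow> ('i \<Rightarrow> nat) \<Rightarrow> real" where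
  "mixed_diff K N \<phi> a = (\<Sum>b\<in>K \<rightarrow>\<^sub>E {..N}. \<phi> b * (\<Prod>j\<in>K. delta_kernel (a j) (b j)))"

lemma of_bool_Ball: "finite K \<Longrightarrow> of_bool (\<forall>j\<in>K. P j) = (\<Prod>j\<in>K. of_bool (P j) :: real)"
  by (induction K rule: finite_induct) auto

lemma delta_kernel_eq_0: "a < b \<or> Suc b < a \<Longrightarrow> delta_kernel a b = 0"
  by (auto simp: delta_kernel_def)

text \<open>The sum telescopes to \<open>[b \<le> v] - [b + 1 \<le> v]\<close>; since
  \<open>v \<le> N\<close>, the cutoff at \<open>N\<close> removes nothing.\<close>

lemma sum_delta_kernel:
  assumes "v \<le> N"
  shows "(\<Sum>a\<le>N. of_bool (a \<le> v) * delta_kernel a b) = of_bool (b = v)"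
proof -
  have "(\<Sum>a\<le>N. of_bool (a \<le> v) * delta_kernel a b) =
      (\<Sum>a\<le>N. if a = b then of_bool (a \<le> v) else 0) - (\<Sum>a\<le>N. if a = Suc b then of_bool (a \<le> v) else 0)"
    by (subst sum_subtractf [symmetric], rule sum.cong) (auto simp: delta_kernel_def)
  also have "\<dots> = of_bool (b = v)"
    using assms by auto
  finally show ?thesis .
qed

lemma sum_delta_kernel_right:
  assumes "a \<le> N"
  shows "(\<Sum>b\<le>N. delta_kernel a b) = of_bool (a = 0)"
proof -
  \<comment> \<open>\<open>of_bool (a > 0)\<close> guards the truncated subtraction: at
    \<open>a = 0\<close> the index \<open>a - 1\<close> is again \<open>0\<close>.\<close>
  have "(\<Sum>b\<le>N. delta_kernel a b) =
      (\<Sum>b\<le>N. if b = a then 1 else 0) - (\<Sum>b\<le>N. if b = a - 1 then of_bool (a > 0) else 0)"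
    by (subst sum_subtractf [symmetric], rule sum.cong) (auto simp: delta_kernel_def)
  also have "\<dots> = of_bool (a = 0)"
    using assms by auto
  finally show ?thesis .
qed

lemma sum_abs_delta_kernel_le: "(\<Sum>b\<le>N. \<bar>delta_kernel a b\<bar>) \<le> 2"
proof -
  have "(\<Sum>b\<le>N. \<bar>delta_kernel a b\<bar>) \<le>
      (\<Sum>b\<le>N. (if b = a then 1 else 0) + (if b = a - 1 then 1 else (0::real)))"
    by (intro sum_mono) (auto simp: delta_kernel_def)
  also have "\<dots> \<le> 2"
    by (simp add: sum.distrib)
  finally show ?thesis .
qed

text \<open>After exchanging the sums, the inner one factors over the coordinates, and
  \<open>sum_delta_kernel\<close> leaves only \<open>b = v\<close>.\<close>

lemma sum_mixed_diff:
  assumes K: "finite K" and v: "v \<in> K \<rightarrow>\<^sub>E {..N}"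
  shows "(\<Sum>a\<in>K \<rightarrow>\<^sub>E {..N}. of_bool (\<forall>j\<in>K. a j \<le> v j) * mixed_diff K N \<phi> a) = \<phi> v"
proof -
  have fin: "finite (K \<rightarrow>\<^sub>E {..N})"
    using K by (intro finite_PiE) auto
  have "(\<Sum>a\<in>K \<rightarrow>\<^sub>E {..N}. of_bool (\<forall>j\<in>K. a j \<le> v j) * mixed_diff K N \<phi> a) =
     (\<Sum>b\<in>K \<rightarrow>\<^sub>E {..N}. \<phi> b * (\<Sum>a\<in>K \<rightarrow>\<^sub>E {..N}. \<Prod>j\<in>K. of_bool (a j \<le> v j) * delta_kernel (a j) (b j)))"
    unfolding mixed_diff_def sum_distrib_left of_bool_Ball [OF K] prod.distrib
    by (subst sum.swap) (simp add: mult_ac)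
  also have "\<dots> = (\<Sum>b\<in>K \<rightarrow>\<^sub>E {..N}. \<phi> b * of_bool (\<forall>j\<in>K. b j = v j))"
  proof (rule sum.cong [OF refl])
    fix b assume "b \<in> K \<rightarrow>\<^sub>E {..N}"
    have "(\<Sum>a\<in>K \<rightarrow>\<^sub>E {..N}. \<Prod>j\<in>K. of_bool (a j \<le> v j) * delta_kernel (a j) (b j)) =
        (\<Prod>j\<in>K. \<Sum>y\<le>N. of_bool (y \<le> v j) * delta_kernel y (b j))"
      using K by (subst prod_sum_PiE) auto
    also have "\<dots> = (\<Prod>j\<in>K. of_bool (b j = v j))"
      using v by (intro prod.cong refl sum_delta_kernel) (auto simp: PiE_iff)
    finally show "\<phi> b * (\<Sum>a\<in>K \<rightarrow>\<^sub>E {..N}. \<Prod>j\<in>K. of_bool (a j \<le> v j) * delta_kernel (a j) (b j)) =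
        \<phi> b * of_bool (\<forall>j\<in>K. b j = v j)"
      by (simp only: of_bool_Ball [OF K])
  qed
  also have "\<dots> = (\<Sum>b\<in>K \<rightarrow>\<^sub>E {..N}. if b = v then \<phi> b else 0)"
    by (intro sum.cong refl) (use v in \<open>auto intro: PiE_ext\<close>)
  also have "\<dots> = \<phi> v"
    using v fin by simp
  finally show ?thesis .
qed

text \<open>The kernel vanishes unless each \<open>b j\<close> is \<open>a j\<close> or
  \<open>a j - 1\<close>. So \<open>lcm_local\<close> may be replaced by any simpler function that
  agrees with it on the unit cube below \<open>a\<close>.\<close>

lemma mixed_diff_cong:
  assumes "finite K"
    and "\<And>b. b \<in> K \<rightarrow>\<^sub>E {..N} \<Longrightarrow> (\<And>j. j \<in> K \<Longrightarrow> b j \<le> a j \<and> a j \<le> Suc (b j)) \<Longrightarrow> \<phi> b = \<psi> b"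
  shows "mixed_diff K N \<phi> a = mixed_diff K N \<psi> a"
  unfolding mixed_diff_def
proof (rule sum.cong [OF refl])
  fix b assume b: "b \<in> K \<rightarrow>\<^sub>E {..N}"
  show "\<phi> b * (\<Prod>j\<in>K. delta_kernel (a j) (b j)) = \<psi> b * (\<Prod>j\<in>K. delta_kernel (a j) (b j))"
  proof (cases "\<forall>j\<in>K. b j \<le> a j \<and> a j \<le> Suc (b j)")
    case True
    then show ?thesis
      using assms(2) [OF b] by simp
  next
    case False
    then obtain j where "j \<in> K" "a j < b j \<or> Suc (b j) < a j"
      by (auto simp: not_le)
    then have "(\<Prod>j\<in>K. delta_kernel (a j) (b j)) = 0"
      using assms(1) delta_kernel_eq_0 by (intro prod_zero) blast+
    then show ?thesis
      by simp
  qed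
qed

lemma mixed_diff_prod:
  assumes "finite K"
  shows "mixed_diff K N (\<lambda>b. \<Prod>j\<in>K. \<psi> j (b j)) a = (\<Prod>j\<in>K. \<Sum>b\<le>N. \<psi> j b * delta_kernel (a j) b)"
  unfolding mixed_diff_def using assms
  by (subst prod_sum_PiE) (auto simp: prod.distrib)

text \<open>Each coordinate of the kernel has absolute mass at most 2. The bound is only asked for
  below \<open>a\<close>, so that \<open>B\<close> may be the value at \<open>a\<close> of an
  increasing function.\<close>

lemma abs_mixed_diff_le:
  assumes "finite K"
    and "\<And>b. b \<in> K \<rightarrow>\<^sub>E {..N} \<Longrightarrow> (\<And>j. j \<in> K \<Longrightarrow> b j \<le> a j) \<Longrightarrow> \<bar>\<phi> b\<bar> \<le> B" and "B \<ge> 0"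
  shows "\<bar>mixed_diff K N \<phi> a\<bar> \<le> B * 2 ^ card K"
proof -
  have "\<bar>mixed_diff K N \<phi> a\<bar> \<le> (\<Sum>b\<in>K \<rightarrow>\<^sub>E {..N}. \<bar>\<phi> b * (\<Prod>j\<in>K. delta_kernel (a j) (b j))\<bar>)"
    unfolding mixed_diff_def by (rule sum_abs)
  also have "\<dots> \<le> (\<Sum>b\<in>K \<rightarrow>\<^sub>E {..N}. B * (\<Prod>j\<in>K. \<bar>delta_kernel (a j) (b j)\<bar>))"
  proof (rule sum_mono)
    fix b assume b: "b \<in> K \<rightarrow>\<^sub>E {..N}"
    show "\<bar>\<phi> b * (\<Prod>j\<in>K. delta_kernel (a j) (b j))\<bar> \<le> B * (\<Prod>j\<in>K. \<bar>delta_kernel (a j) (b j)\<bar>)"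
    proof (cases "\<forall>j\<in>K. b j \<le> a j")
      case True
      then show ?thesis
        using assms(2) [OF b] by (simp add: abs_mult abs_prod mult_right_mono prod_nonneg)
    next
      case False
      then have "(\<Prod>j\<in>K. delta_kernel (a j) (b j)) = 0"
        using assms(1) delta_kernel_eq_0 by (intro prod_zero) (auto simp: not_le)
      then show ?thesis
        using assms(3) by (simp add: prod_nonneg)
    qed
  qed
  also have "\<dots> = B * (\<Prod>j\<in>K. \<Sum>b\<le>N. \<bar>delta_kernel (a j) b\<bar>)"
    using assms(1) by (subst prod_sum_PiE) (auto simp: sum_distrib_left)
  also have "(\<Prod>j\<in>K. \<Sum>b\<le>N. \<bar>delta_kernel (a j) b\<bar>) \<le> (\<Prod>j\<in>K. 2)"
    by (intro prod_mono conjI sum_nonneg sum_abs_delta_kernel_le) auto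
  finally show ?thesis
    using assms(3) by (simp add: mult_left_mono)
qed

text \<open>Split \<open>\<phi>\<close> as \<open>(\<phi> - 1) + 1\<close>: on the corners the first
  part lives at \<open>a\<close> alone, and the differences of the constant vanish except at the
  origin.\<close>

lemma mixed_diff_eq_at_vertex:
  assumes K: "finite K" and a: "a \<in> K \<rightarrow>\<^sub>E {..N}"
    and \<phi>: "\<And>b. b \<in> K \<rightarrow>\<^sub>E {..N} \<Longrightarrow> (\<And>j. j \<in> K \<Longrightarrow> b j \<le> a j) \<Longrightarrow> b \<noteq> a \<Longrightarrow> \<phi> b = 1"
  shows "mixed_diff K N \<phi> a = \<phi> a - 1 + of_bool (\<forall>j\<in>K. a j = 0)"
proof -
  have fin: "finite (K \<rightarrow>\<^sub>E {..N})"
    using K by (intro finite_PiE) auto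
  have "mixed_diff K N \<phi> a =
      mixed_diff K N (\<lambda>b. \<phi> b - 1) a + mixed_diff K N (\<lambda>b. \<Prod>j\<in>K. 1) a"
    by (simp add: mixed_diff_def algebra_simps sum_subtractf)
  also have "mixed_diff K N (\<lambda>b. \<phi> b - 1) a = mixed_diff K N (\<lambda>b. of_bool (b = a) * (\<phi> a - 1)) a"
    using \<phi> by (intro mixed_diff_cong K) auto
  also have "\<dots> = (\<Sum>b\<in>K \<rightarrow>\<^sub>E {..N}. if b = a then \<phi> a - 1 else 0)"
    unfolding mixed_diff_def by (intro sum.cong refl) (auto simp: delta_kernel_def)
  also have "\<dots> = \<phi> a - 1"
    using a fin by simp
  also have "mixed_diff K N (\<lambda>b. \<Prod>j\<in>K. 1) a = (\<Prod>j\<in>K. \<Sum>b\<le>N. 1 * delta_kernel (a j) b)"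
    by (rule mixed_diff_prod [OF K])
  also have "\<dots> = of_bool (\<forall>j\<in>K. a j = 0)"
    unfolding of_bool_Ball [OF K]
    using a by (intro prod.cong refl) (auto simp: sum_delta_kernel_right PiE_iff)
  finally show ?thesis .
qed

text \<open>The factor at \<open>p\<close> of \<open>(lcm(n_1, ..., n_k) / (n_1 ... n_k))^r\<close>
  when \<open>p\<close> has exponent \<open>a j\<close> in \<open>n_j\<close>.\<close>

definition lcm_local :: "real \<Rightarrow> 'i set \<Rightarrow> nat \<Rightarrow> ('i \<Rightarrow> nat) \<Rightarrow> real" where
  "lcm_local r K p a = real p powr (r * (real (MAX j\<in>K. a j) - real (\<Sum>j\<in>K. a j)))"

section \<open>Size and monotonicity of the local factors\<close>

lemma lcm_local_cong: "(\<And>j. j \<in> K \<Longrightarrow> a j = b j) \<Longrightarrow> lcm_local r K p a = lcm_local r K p b"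
  by (simp add: lcm_local_def cong: image_cong sum.cong)

text \<open>Remove an index \<open>i\<close> where \<open>a\<close> is largest: the rest of the sum
  is monotone, and \<open>b i\<close> is at most the maximum of \<open>b\<close>. So the excess of
  the sum over the maximum grows with the vector; the additive form avoids subtraction of
  naturals.\<close>

lemma excess_mono:
  assumes "finite K" "K \<noteq> {}" and le: "\<And>j. j \<in> K \<Longrightarrow> b j \<le> (a j :: nat)"
  shows "(\<Sum>j\<in>K. b j) + (MAX j\<in>K. a j) \<le> (\<Sum>j\<in>K. a j) + (MAX j\<in>K. b j)"
proof -
  have "Max (a ` K) \<in> a ` K"
    using assms by (intro Max_in) auto
  then obtain i where i: "i \<in> K" "Max (a ` K) = a i"
    by auto
  have "(\<Sum>j\<in>K - {i}. b j) \<le> (\<Sum>j\<in>K - {i}. a j)"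
    by (intro sum_mono) (use le in auto)
  moreover have "b i \<le> Max (b ` K)"
    using i assms by (intro Max_ge) auto
  moreover have "(\<Sum>j\<in>K. b j) = b i + (\<Sum>j\<in>K - {i}. b j)" "(\<Sum>j\<in>K. a j) = a i + (\<Sum>j\<in>K - {i}. a j)"
    using i assms(1) by (auto simp: sum.remove [of K i])
  ultimately show ?thesis
    using i(2) by linarith
qed

lemma Max_le_sum:
  assumes "finite K" "K \<noteq> {}"
  shows "(MAX j\<in>K. a j) \<le> (\<Sum>j\<in>K. a j :: nat)"
  using assms by (intro Max.boundedI) (auto intro: member_le_sum)

lemma lcm_local_le_1:
  assumes "finite K" "K \<noteq> {}" "r \<ge> 0" "p \<ge> 1"
  shows "lcm_local r K p a \<le> 1"
proof -
  have "r * (real (MAX j\<in>K. a j) - real (\<Sum>j\<in>K. a j)) \<le> 0"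
    using Max_le_sum [of K a] assms by (intro mult_nonneg_nonpos) (auto simp del: of_nat_sum)
  then show ?thesis
    using powr_mono [of "r * (real (MAX j\<in>K. a j) - real (\<Sum>j\<in>K. a j))" 0 "real p"] assms(4)
    by (simp add: lcm_local_def)
qed

text \<open>An excess \<open>c\<close> contributes the factor \<open>p powr (- r * c)\<close>, with
  a nonnegative multiple of \<open>c\<close> in the exponent. Hence the value at \<open>a\<close>
  dominates those at all corners below it, and negative powers of the truncated products will
  increase with the cutoff.\<close>

lemma lcm_local_mono:
  assumes "finite K" "K \<noteq> {}" "r \<le> 0" "p \<ge> 1" "\<And>j. j \<in> K \<Longrightarrow> b j \<le> a j"
  shows "lcm_local r K p b \<le> lcm_local r K p a"
proof -
  have "real (MAX j\<in>K. a j) - real (\<Sum>j\<in>K. a j) \<le> real (MAX j\<in>K. b j) - real (\<Sum>j\<in>K. b j)"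
    using excess_mono [of K b a] assms by (simp del: of_nat_sum)
  then show ?thesis
    unfolding lcm_local_def using assms(3,4) by (intro powr_mono mult_left_mono_neg) auto
qed

lemma mixed_diff_lcm_local_0:
  assumes "finite K" "K \<noteq> {}" "p \<ge> 1" "a \<in> K \<rightarrow>\<^sub>E {..N}" "\<And>j. j \<in> K \<Longrightarrow> a j = 0"
  shows "mixed_diff K N (lcm_local r K p) a = 1"
proof -
  have "lcm_local r K p a = lcm_local r K p (\<lambda>_. 0)"
    using assms by (intro lcm_local_cong) auto
  also have "\<dots> = 1"
    using assms by (simp add: lcm_local_def)
  finally have "lcm_local r K p a = 1" .
  moreover have "b = a" if "b \<in> K \<rightarrow>\<^sub>E {..N}" "\<And>j. j \<in> K \<Longrightarrow> b j \<le> a j" for b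
  proof (rule PiE_ext [OF that(1) assms(4)])
    show "b j = a j" if "j \<in> K" for j
      using \<open>\<And>j. j \<in> K \<Longrightarrow> b j \<le> a j\<close> [OF that] assms(5) [OF that] by simp
  qed
  then have "mixed_diff K N (lcm_local r K p) a =
      lcm_local r K p a - 1 + of_bool (\<forall>j\<in>K. a j = 0)"
    using assms(1,4) by (intro mixed_diff_eq_at_vertex) blast+
  ultimately show ?thesis
    using assms(5) by simp
qed

text \<open>If the maximum is attained only at \<open>i\<close>, then near \<open>a\<close> the function \<^const>\<open>lcm_local\<close> is a
  product over the coordinates whose factor at \<open>i\<close> is constant.\<close>

lemma mixed_diff_lcm_local_unique_max:
  assumes K: "finite K" and a: "a \<in> K \<rightarrow>\<^sub>E {..N}" and i: "i \<in> K"
    and less: "\<And>j. j \<in> K \<Longrightarrow> j \<noteq> i \<Longrightarrow> a j < a i" and pos: "a i > 0" and p: "p \<ge> 1"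
  shows "mixed_diff K N (lcm_local r K p) a = 0"
proof -
  define \<psi> where "\<psi> = (\<lambda>j (n::nat). if j = i then 1 else real p powr (- r * real n))"
  have "lcm_local r K p b = (\<Prod>j\<in>K. \<psi> j (b j))"
    if b: "b \<in> K \<rightarrow>\<^sub>E {..N}" "\<And>j. j \<in> K \<Longrightarrow> b j \<le> a j \<and> a j \<le> Suc (b j)" for b
  proof -
    have "b j \<le> b i" if "j \<in> K" for j
      using b(2) [OF that] b(2) [OF i] less [OF that] by (cases "j = i") auto
    then have "(MAX j\<in>K. b j) = b i"
      using i K by (intro Max_eqI) auto
    then have "lcm_local r K p b = real p powr (\<Sum>j\<in>K - {i}. - r * real (b j))"
      using K i by (simp add: lcm_local_def sum.remove [of K i] sum_distrib_left sum_negf)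
    also have "\<dots> = (\<Prod>j\<in>K - {i}. \<psi> j (b j))"
      using K p by (subst powr_sum) (auto simp: \<psi>_def)
    also have "\<dots> = (\<Prod>j\<in>K. \<psi> j (b j))"
      using K i by (simp add: prod.remove [of K i] \<psi>_def)
    finally show ?thesis .
  qed
  then have "mixed_diff K N (lcm_local r K p) a = mixed_diff K N (\<lambda>b. \<Prod>j\<in>K. \<psi> j (b j)) a"
    using K by (intro mixed_diff_cong) blast+
  also have "\<dots> = (\<Prod>j\<in>K. \<Sum>b\<le>N. \<psi> j b * delta_kernel (a j) b)"
    by (rule mixed_diff_prod [OF K])
  also have "\<dots> = 0"
  proof (intro prod_zero K bexI [OF _ i])
    have "(\<Sum>b\<le>N. \<psi> i b * delta_kernel (a i) b) = (\<Sum>b\<le>N. delta_kernel (a i) b)"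
      by (simp add: \<psi>_def)
    then show "(\<Sum>b\<le>N. \<psi> i b * delta_kernel (a i) b) = 0"
      using a i pos by (subst (asm) sum_delta_kernel_right) (auto simp: PiE_iff)
  qed
  finally show ?thesis .
qed

text \<open>Of the four corners only \<open>a\<close> itself has positive excess, namely 1. The
  exact value matters: for \<open>r \<ge> 0\<close> its size is at most 1, below the general bound
  \<open>2 ^ card K\<close>, and this keeps the power of the logarithm at
  \<open>k - 1\<close>.\<close>

lemma mixed_diff_lcm_local_pair:
  assumes K: "finite K" and a: "a \<in> K \<rightarrow>\<^sub>E {..N}" and ij: "i \<in> K" "j \<in> K" "i \<noteq> j"
    and a_ij: "a i = 1" "a j = 1" and zero: "\<And>l. l \<in> K \<Longrightarrow> l \<noteq> i \<Longrightarrow> l \<noteq> j \<Longrightarrow> a l = 0"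
    and p: "p \<ge> 1"
  shows "mixed_diff K N (lcm_local r K p) a = real p powr (- r) - 1"
proof -
  have sum2: "(\<Sum>l\<in>K. b l) = b i + b j" if "\<And>l. l \<in> K \<Longrightarrow> b l \<le> a l" for b
  proof -
    have "(\<Sum>l\<in>K. b l) = (\<Sum>l\<in>{i, j}. b l)"
    proof (rule sum.mono_neutral_right)
      show "\<forall>l\<in>K - {i, j}. b l = 0"
        using that zero by fastforce
    qed (use K ij in auto)
    then show ?thesis
      using ij by simp
  qed
  have max2: "(MAX l\<in>K. b l) = max (b i) (b j)" if "\<And>l. l \<in> K \<Longrightarrow> b l \<le> a l" for b
  proof (rule Max_eqI)
    fix y assume "y \<in> b ` K"
    then obtain l where l: "l \<in> K" "y = b l"
      by auto
    then show "y \<le> max (b i) (b j)"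
      using that [of l] zero [of l] by (cases "l = i \<or> l = j") auto
  next
    show "max (b i) (b j) \<in> b ` K"
      using ij by (auto simp: max_def)
  qed (use K in auto)
  have "lcm_local r K p b = 1"
    if b: "b \<in> K \<rightarrow>\<^sub>E {..N}" "\<And>l. l \<in> K \<Longrightarrow> b l \<le> a l" "b \<noteq> a" for b
  proof -
    have "\<not> (b i = 1 \<and> b j = 1)"
    proof
      assume "b i = 1 \<and> b j = 1"
      then have "b l = a l" if "l \<in> K" for l
        using a_ij b(2) [OF that] zero [OF that] by (cases "l = i \<or> l = j") auto
      then have "b = a"
        using a b(1) by (intro PiE_ext [of b K _ a]) auto
      with b(3) show False
        by simp
    qed
    then have "b i = 0 \<or> b j = 0"
      using b(2) [of i] b(2) [of j] ij a_ij by auto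
    then show ?thesis
      using sum2 [of b] max2 [of b] b(2) p by (auto simp: lcm_local_def)
  qed
  then have "mixed_diff K N (lcm_local r K p) a = lcm_local r K p a - 1 + of_bool (\<forall>j\<in>K. a j = 0)"
    using K a by (intro mixed_diff_eq_at_vertex) blast+
  moreover have "\<not> (\<forall>j\<in>K. a j = 0)"
    using ij a_ij by force
  moreover have "lcm_local r K p a = real p powr (- r)"
    using sum2 [of a] max2 [of a] a_ij by (simp add: lcm_local_def)
  ultimately show ?thesis
    by simp
qed

subsection \<open>Local factors\<close>

text \<open>A unique maximum makes the difference vanish, so the maximum is attained twice, and one
  of the two indices differs from \<open>i\<close>. The exponents outside \<open>i\<close> then sum
  to at least \<open>a i\<close>, which will absorb the weight \<open>s * a i\<close>.\<close>

lemma mixed_diff_lcm_local_support: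
  assumes K: "finite K" "i \<in> K" and a: "a \<in> K \<rightarrow>\<^sub>E {..N}" and p: "p \<ge> 1"
    and nz: "mixed_diff K N (lcm_local r K p) a \<noteq> 0" and "a \<noteq> (\<lambda>j\<in>K. 0)"
  obtains m l where "m \<in> K" "l \<in> K" "m \<noteq> i" "l \<noteq> m" "a l = a m" "a m > 0" "\<And>j. j \<in> K \<Longrightarrow> a j \<le> a m"
proof -
  have "Max (a ` K) \<in> a ` K"
    using K by (intro Max_in) auto
  then obtain m where m: "m \<in> K" "a m = Max (a ` K)"
    by auto
  then have le: "a j \<le> a m" if "j \<in> K" for j
    using K that by simp
  have pos: "a m > 0"
  proof (rule ccontr)
    assume "\<not> a m > 0"
    then have "a j = 0" if "j \<in> K" for j
      using le [OF that] by simp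
    then have "a = (\<lambda>j\<in>K. 0)"
      using a by (intro ext) (auto simp: PiE_iff extensional_def)
    with assms show False
      by simp
  qed
  have "\<exists>l\<in>K. l \<noteq> m \<and> a l = a m"
  proof (rule ccontr)
    assume "\<not> (\<exists>l\<in>K. l \<noteq> m \<and> a l = a m)"
    then have "mixed_diff K N (lcm_local r K p) a = 0"
      using le by (intro mixed_diff_lcm_local_unique_max [OF K(1) a m(1) _ pos p]) (metis le_neq_implies_less)
    with nz show False
      by simp
  qed
  then obtain l where l: "l \<in> K" "l \<noteq> m" "a l = a m"
    by blast
  show ?thesis
  proof (cases "m = i")
    case True
    then show ?thesis
      using that [of l m] l m pos le by simp
  next
    case False
    then show ?thesis
      using that [of m l] l m pos le by simp
  qed
qed

lemma prod_powr_power_eq: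
  assumes "finite K"
  shows "(\<Prod>j\<in>K. (2 powr c) ^ a j) = 2 powr (c * real (\<Sum>j\<in>K. a j))"
  using assms by (induction K rule: finite_induct) (simp_all add: powr_power powr_add [symmetric] algebra_simps)

lemma sum_prod_geometric_le:
  fixes q :: real
  assumes K: "finite K" and q: "0 \<le> q" "q < 1"
  shows "(\<Sum>a\<in>K \<rightarrow>\<^sub>E {..N}. \<Prod>j\<in>K. q ^ a j) \<le> (1 / (1 - q)) ^ card K"
proof -
  have "(\<Sum>a\<in>K \<rightarrow>\<^sub>E {..N}. \<Prod>j\<in>K. q ^ a j) = (\<Prod>j\<in>K. \<Sum>c\<le>N. q ^ c)"
    using K by (subst prod_sum_PiE) auto
  also have "\<dots> \<le> (\<Prod>j\<in>K. 1 / (1 - q))"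
  proof (rule prod_mono)
    have "(\<Sum>c\<le>N. q ^ c) = (1 - q ^ Suc N) / (1 - q)"
      using q by (subst sum_gp0) auto
    also have "\<dots> \<le> 1 / (1 - q)"
      using q by (intro divide_right_mono) auto
    finally show "0 \<le> (\<Sum>c\<le>N. q ^ c) \<and> (\<Sum>c\<le>N. q ^ c) \<le> 1 / (1 - q)"
      using q by (simp add: sum_nonneg)
  qed
  finally show ?thesis
    by simp
qed

text \<open>The Euler factor at \<open>p\<close> of the sum of
  \<open>|g(d)| d_i^s / (d_1 ... d_k)\<close>, with exponents cut off at \<open>N\<close>.\<close>

definition local_series :: "real \<Rightarrow> 'i set \<Rightarrow> nat \<Rightarrow> 'i \<Rightarrow> real \<Rightarrow> nat \<Rightarrow> real" where
  "local_series r K N i s p = (\<Sum>a\<in>K \<rightarrow>\<^sub>E {..N}. \<bar>mixed_diff K N (lcm_local r K p) a\<bar> *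
     real p powr (s * real (a i) - real (\<Sum>j\<in>K. a j)))"

text \<open>Let \<open>T\<close> be the sum of the exponents outside \<open>i\<close>, and consider
  nonvanishing differences away from the origin. \<open>T = 1\<close> forces exponent 1 at
  \<open>i\<close> and at one other index: \<open>card K - 1\<close> terms of weight
  \<open>p powr (s - 2)\<close>. For \<open>T \<ge> 2\<close> the weight is at most
  \<open>p powr (- T)\<close>, so these terms total \<open>O(p powr (- 2))\<close>, uniformly in
  \<open>s \<le> 1\<close>.\<close>

lemma local_series_le_nonneg:
  assumes K: "finite K" "i \<in> K" and r: "r \<ge> 0" and p: "p \<ge> 2" and s: "0 \<le> s" "s \<le> 1"
  shows "local_series r K N i s p \<le> 1 + real (card K - 1) * real p powr (s - 2) +
     4 * 2 ^ card K * (1 / (1 - 2 powr (-1/2))) ^ card K * real p powr (-2)"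
proof -
  let ?g = "mixed_diff K N (lcm_local r K p)"
  let ?w = "\<lambda>a. real p powr (s * real (a i) - real (\<Sum>j\<in>K. a j))"
  define e where "e = (\<lambda>j. \<lambda>l\<in>K. of_bool (l = i \<or> l = j) :: nat)"
  define z where "z = (\<lambda>j\<in>K. 0 :: nat)"
  define D where "D = 4 * 2 ^ card K * real p powr (-2)"
  have fin: "finite (K \<rightarrow>\<^sub>E {..N})"
    using K by (intro finite_PiE) auto
  have D: "D \<ge> 0"
    by (simp add: D_def)
  have nn: "0 \<le> (\<Sum>j\<in>K - {i}. of_bool (a = e j) * real p powr (s - 2))"
       "0 \<le> D * (\<Prod>j\<in>K. (2 powr (-1/2)) ^ a j)" for a
    using D by (auto intro!: sum_nonneg mult_nonneg_nonneg prod_nonneg)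
  have "\<bar>?g a\<bar> * ?w a \<le> of_bool (a = z) + (\<Sum>j\<in>K - {i}. of_bool (a = e j) * real p powr (s - 2)) +
      D * (\<Prod>j\<in>K. (2 powr (-1/2)) ^ a j)" if a: "a \<in> K \<rightarrow>\<^sub>E {..N}" for a
  proof -
    consider "a = z" | "a \<noteq> z" "?g a = 0" | "a \<noteq> z" "?g a \<noteq> 0"
      by blast
    then show ?thesis
    proof cases
      case 1
      then have "?g a = 1" "?w a = 1"
        using K p a by (auto intro!: mixed_diff_lcm_local_0 simp: z_def)
      then show ?thesis
        using nn [of a] 1 by simp
    next
      case 2
      then show ?thesis
        using nn [of a] by simp
    next
      case 3
      then obtain m l where ml: "m \<in> K" "l \<in> K" "m \<noteq> i" "l \<noteq> m" "a l = a m" "a m > 0"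
          "\<And>j. j \<in> K \<Longrightarrow> a j \<le> a m"
        using mixed_diff_lcm_local_support [OF K a _ 3(2)] p by (auto simp: z_def)
      define T where "T = (\<Sum>j\<in>K - {i}. a j)"
      have sum_eq: "(\<Sum>j\<in>K. a j) = a i + T"
        using K by (simp add: T_def sum.remove [of K i])
      have T_m: "T = a m + (\<Sum>j\<in>K - {i} - {m}. a j)"
        unfolding T_def using K ml by (subst sum.remove [of "K - {i}" m]) auto
      have "a i \<le> T"
        using ml(7) [of i] K T_m by simp
      show ?thesis
      proof (cases "T = 1")
        case True
        then have am: "a m = 1" and rest: "(\<Sum>j\<in>K - {i} - {m}. a j) = 0"
          using T_m ml(6) by auto
        have rest0: "a j = 0" if "j \<in> K" "j \<noteq> i" "j \<noteq> m" for j
          using rest that K by (simp add: sum_eq_0_iff)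
        \<comment> \<open>Otherwise \<open>l\<close> would be one of the remaining indices, whose
          exponents are 0, while \<open>a l = a m = 1\<close>.\<close>
        then have "l = i"
          using ml am by force
        then have ai: "a i = 1"
          using ml am by simp
        have "?g a = real p powr (- r) - 1"
          using K ml ai am rest0 p by (intro mixed_diff_lcm_local_pair [OF _ a, of i m]) auto
        moreover have "real p powr (- r) \<le> 1"
          using p r powr_mono [of "- r" 0 "real p"] by simp
        ultimately have g: "\<bar>?g a\<bar> \<le> 1"
          by simp
        have w: "?w a = real p powr (s - 2)"
          unfolding sum_eq True ai by simp
        have "a = e m"
          using a ai am rest0 by (intro ext) (auto simp: e_def PiE_iff extensional_def)
        then have "real p powr (s - 2) = (\<Sum>j\<in>{m}. of_bool (a = e j) * real p powr (s - 2))"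
          by simp
        also have "\<dots> \<le> (\<Sum>j\<in>K - {i}. of_bool (a = e j) * real p powr (s - 2))"
          using K ml by (intro sum_mono2) auto
        finally show ?thesis
          using mult_right_mono [OF g, of "?w a"] nn(2) [of a] w 3 by simp
      next
        case False
        have "T \<ge> 2"
          using False T_m ml(6) by simp
        have "\<bar>?g a\<bar> \<le> 1 * 2 ^ card K"
        proof (rule abs_mixed_diff_le [OF K(1)])
          fix b
          show "\<bar>lcm_local r K p b\<bar> \<le> 1"
            using lcm_local_le_1 [of K r p b] K r p by (auto simp: lcm_local_def)
        qed simp
        moreover have "?w a \<le> 4 * real p powr (-2) * (\<Prod>j\<in>K. (2 powr (-1/2)) ^ a j)"
        proof -
          have "s * real (a i) \<le> real (a i)"
            using s by (simp add: mult_left_le_one_le)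
          then have "?w a \<le> real p powr (- real T)"
            using p by (intro powr_mono) (auto simp: sum_eq simp del: of_nat_sum)
          also have "\<dots> = real p powr (-2) * real p powr (2 - real T)"
            by (simp add: powr_add [symmetric])
          finally have w: "?w a \<le> real p powr (-2) * real p powr (2 - real T)" .
          \<comment> \<open>The exponent is nonpositive, so \<open>p\<close> may be replaced by 2.
            Then \<open>a i \<le> T\<close> gives \<open>T \<ge> (a i + T) / 2\<close>, whence the
            ratio \<open>2 powr (-1/2)\<close> and the factor 4.\<close>
          have "real p powr (2 - real T) \<le> 2 powr (2 - real T)"
            using p \<open>T \<ge> 2\<close> by (intro powr_mono2') auto
          also have "2 powr (2 - real T) \<le> 2 powr (2 + (-1/2) * real (\<Sum>j\<in>K. a j))"
            using \<open>a i \<le> T\<close> by (intro powr_mono) (auto simp: sum_eq simp del: of_nat_sum)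
          also have "\<dots> = 4 * (\<Prod>j\<in>K. (2 powr (-1/2)) ^ a j)"
            using K by (subst powr_add, subst prod_powr_power_eq) auto
          finally have "real p powr (-2) * real p powr (2 - real T) \<le>
              real p powr (-2) * (4 * (\<Prod>j\<in>K. (2 powr (-1/2)) ^ a j))"
            by (intro mult_left_mono) auto
          with w show ?thesis
            by (simp add: mult_ac)
        qed
        ultimately have "\<bar>?g a\<bar> * ?w a \<le> (1 * 2 ^ card K) * (4 * real p powr (-2) * (\<Prod>j\<in>K. (2 powr (-1/2)) ^ a j))"
          by (intro mult_mono) auto
        then show ?thesis
          using nn(1) [of a] 3 by (simp add: D_def mult_ac)
      qed
    qed
  qed
  then have "local_series r K N i s p \<le> (\<Sum>a\<in>K \<rightarrow>\<^sub>E {..N}. of_bool (a = z) +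
      (\<Sum>j\<in>K - {i}. of_bool (a = e j) * real p powr (s - 2)) + D * (\<Prod>j\<in>K. (2 powr (-1/2)) ^ a j))"
    unfolding local_series_def by (rule sum_mono)
  also have "\<dots> = (\<Sum>a\<in>K \<rightarrow>\<^sub>E {..N}. of_bool (a = z)) +
      (\<Sum>j\<in>K - {i}. (\<Sum>a\<in>K \<rightarrow>\<^sub>E {..N}. of_bool (a = e j)) * real p powr (s - 2)) +
      D * (\<Sum>a\<in>K \<rightarrow>\<^sub>E {..N}. \<Prod>j\<in>K. (2 powr (-1/2)) ^ a j)"
    unfolding sum.distrib sum_distrib_left sum_distrib_right
    by (subst sum.swap [of _ "K - {i}"]) simp
  also have "\<dots> \<le> 1 + (\<Sum>j\<in>K - {i}. 1 * real p powr (s - 2)) + D * (1 / (1 - 2 powr (-1/2))) ^ card K"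
  proof (intro add_mono sum_mono mult_left_mono mult_right_mono sum_prod_geometric_le K D)
    have "(2::real) powr (-1/2) < 2 powr 0"
      by (intro powr_less_mono) auto
    then show "(2::real) powr (-1/2) < 1"
      by simp
  qed (use fin in \<open>auto simp: of_bool_def\<close>)
  finally show ?thesis
    using K by (simp add: D_def mult_ac)
qed

text \<open>For \<open>r \<le> 0\<close> the value of \<open>lcm_local\<close> at \<open>a\<close>
  bounds every corner, which turns each term into a single power of \<open>p\<close>. Its exponent
  stays below \<open>-1\<close> by a margin that also pays for the geometric series over
  \<open>a\<close>.\<close>

lemma local_series_le_nonpos:
  assumes K: "finite K" "i \<in> K" and r: "-1 < r" "r \<le> 0" and p: "p \<ge> 2"
  defines "s \<equiv> (1 + r) / 2"
  shows "local_series r K N i s p \<le> 1 +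
     2 ^ card K * (1 / (1 - 2 powr (- s / 4))) ^ card K * real p powr (- 1 - s / 2)"
proof -
  let ?g = "mixed_diff K N (lcm_local r K p)"
  let ?w = "\<lambda>a. real p powr (s * real (a i) - real (\<Sum>j\<in>K. a j))"
  define z where "z = (\<lambda>j\<in>K. 0 :: nat)"
  define D where "D = 2 ^ card K * real p powr (- 1 - s / 2)"
  have s: "s > 0" "r = 2 * s - 1"
    using r by (auto simp: s_def field_simps)
  have fin: "finite (K \<rightarrow>\<^sub>E {..N})"
    using K by (intro finite_PiE) auto
  have D: "D \<ge> 0"
    by (simp add: D_def)
  have nn: "0 \<le> D * (\<Prod>j\<in>K. (2 powr (- s / 4)) ^ a j)" for a
    using D by (auto intro!: sum_nonneg mult_nonneg_nonneg prod_nonneg)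
  have "\<bar>?g a\<bar> * ?w a \<le> of_bool (a = z) + D * (\<Prod>j\<in>K. (2 powr (- s / 4)) ^ a j)"
    if a: "a \<in> K \<rightarrow>\<^sub>E {..N}" for a
  proof -
    consider "a = z" | "a \<noteq> z" "?g a = 0" | "a \<noteq> z" "?g a \<noteq> 0"
      by blast
    then show ?thesis
    proof cases
      case 1
      then have "?g a = 1" "?w a = 1"
        using K p a by (auto intro!: mixed_diff_lcm_local_0 simp: z_def)
      then show ?thesis
        using nn [of a] 1 by simp
    next
      case 2
      then show ?thesis
        using nn [of a] by simp
    next
      case 3
      then obtain m l where ml: "m \<in> K" "l \<in> K" "m \<noteq> i" "l \<noteq> m" "a l = a m" "a m > 0"
          "\<And>j. j \<in> K \<Longrightarrow> a j \<le> a m"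
        using mixed_diff_lcm_local_support [OF K a _ 3(2)] p by (auto simp: z_def)
      define S where "S = real (\<Sum>j\<in>K. a j)"
      have max: "(MAX j\<in>K. a j) = a m"
        using K ml by (intro Max_eqI) auto
      have "(\<Sum>j\<in>{l, m}. a j) \<le> (\<Sum>j\<in>K. a j)"
        using K ml by (intro sum_mono2) auto
      then have S: "2 * real (a m) \<le> S"
        using ml by (simp add: S_def del: of_nat_sum)
      have "\<bar>?g a\<bar> \<le> lcm_local r K p a * 2 ^ card K"
      proof (rule abs_mixed_diff_le [OF K(1)])
        fix b assume "\<And>j. j \<in> K \<Longrightarrow> b j \<le> a j"
        then show "\<bar>lcm_local r K p b\<bar> \<le> lcm_local r K p a"
          using lcm_local_mono [of K r p b a] K r p by (auto simp: lcm_local_def)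
      qed (simp add: lcm_local_def)
      then have "\<bar>?g a\<bar> * ?w a \<le> (lcm_local r K p a * 2 ^ card K) * ?w a"
        by (intro mult_right_mono) auto
      also have "\<dots> = 2 ^ card K * real p powr (r * (real (a m) - S) + (s * real (a i) - S))"
        by (simp add: lcm_local_def max S_def powr_add)
      \<comment> \<open>With \<open>r = 2 * s - 1\<close> and \<open>a i \<le> a m\<close> the
        exponent is at most \<open>3 * s * a m - 2 * s * S - a m\<close>. A share
        \<open>s * S / 4\<close> is reserved for the geometric series; as
        \<open>S \<ge> 2 * a m\<close>, the rest is at most \<open>- (1 + s / 2) * a m\<close>, and
        \<open>a m \<ge> 1\<close>.\<close>
      also have "\<dots> \<le> 2 ^ card K * real p powr ((- 1 - s / 2) + (- s / 4) * S)"
      proof (intro mult_left_mono powr_mono)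
        have "s * real (a i) \<le> s * real (a m)"
          using ml(7) [of i] K s by simp
        moreover have "s * (2 * real (a m)) \<le> s * S"
          using S s by (intro mult_left_mono) auto
        moreover have "s * 1 \<le> s * real (a m)"
          using ml(6) s by (intro mult_left_mono) auto
        moreover have "real (a m) \<ge> 1"
          using ml(6) by simp
        ultimately show "r * (real (a m) - S) + (s * real (a i) - S) \<le> (- 1 - s / 2) + (- s / 4) * S"
          unfolding s(2) by (simp add: algebra_simps)
      qed (use p in auto)
      also have "\<dots> = D * real p powr ((- s / 4) * S)"
        by (simp add: powr_add [symmetric] D_def)
      also have "\<dots> \<le> D * 2 powr ((- s / 4) * S)"
        using p s by (intro mult_left_mono powr_mono2' D) (auto simp: S_def sum_nonneg)
      also have "2 powr ((- s / 4) * S) = (\<Prod>j\<in>K. (2 powr (- s / 4)) ^ a j)"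
        using K by (subst prod_powr_power_eq) (auto simp: S_def)
      finally show ?thesis
        using 3 by simp
    qed
  qed
  then have "local_series r K N i s p \<le>
      (\<Sum>a\<in>K \<rightarrow>\<^sub>E {..N}. of_bool (a = z) + D * (\<Prod>j\<in>K. (2 powr (- s / 4)) ^ a j))"
    unfolding local_series_def by (rule sum_mono)
  also have "\<dots> = (\<Sum>a\<in>K \<rightarrow>\<^sub>E {..N}. of_bool (a = z)) +
      D * (\<Sum>a\<in>K \<rightarrow>\<^sub>E {..N}. \<Prod>j\<in>K. (2 powr (- s / 4)) ^ a j)"
    by (simp add: sum.distrib sum_distrib_left)
  also have "\<dots> \<le> 1 + D * (1 / (1 - 2 powr (- s / 4))) ^ card K"
  proof (intro add_mono mult_left_mono sum_prod_geometric_le K D)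
    have "(2::real) powr (- s / 4) < 2 powr 0"
      using s by (intro powr_less_mono) auto
    then show "(2::real) powr (- s / 4) < 1"
      by simp
  qed (use fin in \<open>auto simp: of_bool_def\<close>)
  finally show ?thesis
    by (simp add: D_def mult_ac)
qed

subsection \<open>Euler products\<close>

lemma powr_Suc_diff_mvt:
  assumes "t > (0::real)"
  obtains \<xi> where "t < \<xi>" "\<xi> < t + 1" "(t + 1) powr \<beta> - t powr \<beta> = \<beta> * \<xi> powr (\<beta> - 1)"
proof -
  have "\<exists>\<xi>. t < \<xi> \<and> \<xi> < t + 1 \<and> (t + 1) powr \<beta> - t powr \<beta> = (t + 1 - t) * (\<beta> * \<xi> powr (\<beta> - 1))"
    using assms by (intro MVT2) (auto intro!: derivative_eq_intros)
  then show ?thesis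
    using that by auto
qed

text \<open>Comparison with the integral of \<open>t powr (- u)\<close> from 1 on. The index set is
  any finite set of positive integers, because the bound is applied to squarefree numbers as well as
  to primes.\<close>

lemma sum_powr_le:
  fixes u :: real
  assumes u: "u > 1" and F: "finite F" "0 \<notin> F"
  shows "(\<Sum>n\<in>F. real n powr (- u)) \<le> 1 + 1 / (u - 1)"
proof -
  have *: "(\<Sum>n=1..Suc M. real n powr (- u)) \<le> 1 + (1 - real (Suc M) powr (1 - u)) / (u - 1)" for M
  proof (induction M)
    case (Suc M)
    obtain \<xi> where \<xi>: "real (Suc M) < \<xi>" "\<xi> < real (Suc M) + 1"
        "(real (Suc M) + 1) powr (1 - u) - real (Suc M) powr (1 - u) = (1 - u) * \<xi> powr (1 - u - 1)"
      using powr_Suc_diff_mvt [of "real (Suc M)" "1 - u"] by auto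
    have "real (Suc (Suc M)) powr (- u) \<le> \<xi> powr (- u)"
      using \<xi> u by (intro powr_mono2') auto
    also have "\<dots> = (real (Suc M) powr (1 - u) - real (Suc (Suc M)) powr (1 - u)) / (u - 1)"
      using \<xi>(3) u by (simp add: field_simps add.commute)
    finally have "(\<Sum>n=1..Suc (Suc M). real n powr (- u)) \<le> 1 + (1 - real (Suc M) powr (1 - u)) / (u - 1) +
        (real (Suc M) powr (1 - u) - real (Suc (Suc M)) powr (1 - u)) / (u - 1)"
      using Suc by simp
    then show ?case
      by (simp add: diff_divide_distrib)
  qed (use u in auto)
  obtain M where M: "F \<subseteq> {1..Suc M}"
  proof
    show "F \<subseteq> {1..Suc (Max F)}"
      using F by (auto simp: Suc_le_eq le_SucI) (metis gr0I)
  qed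
  have "(\<Sum>n\<in>F. real n powr (- u)) \<le> (\<Sum>n=1..Suc M. real n powr (- u))"
    using M by (intro sum_mono2) auto
  also have "\<dots> \<le> 1 + (1 - real (Suc M) powr (1 - u)) / (u - 1)"
    by (rule *)
  also have "\<dots> \<le> 1 + 1 / (u - 1)"
    using u by (intro add_left_mono divide_right_mono) auto
  finally show ?thesis .
qed

text \<open>A set of primes is recovered from its product as the set of primes of multiplicity
  1.\<close>

lemma inj_on_prod_primes:
  assumes P: "finite P" "\<And>p. p \<in> P \<Longrightarrow> prime (p::nat)"
  shows "inj_on (\<lambda>S. \<Prod>p\<in>S. p) (Pow P)"
proof (rule inj_onI)
  have *: "S = {p. prime p \<and> multiplicity p (\<Prod>p\<in>S. p) = 1}" if "S \<in> Pow P" for S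
  proof -
    have S: "finite S" "\<And>p. p \<in> S \<Longrightarrow> prime p"
      using that P finite_subset by auto
    have "multiplicity p (\<Prod>p\<in>S. p) = 1 \<longleftrightarrow> p \<in> S" if "prime p" for p
      using multiplicity_prod_prime_powers [OF S that, of "\<lambda>_. 1"] by simp
    then show ?thesis
      using S(2) by blast
  qed
  fix S T assume "S \<in> Pow P" "T \<in> Pow P" "(\<Prod>p\<in>S. p) = (\<Prod>p\<in>T. p)"
  then show "S = T"
    using * [of S] * [of T] by simp
qed

text \<open>Multiplying out gives a sum over distinct squarefree numbers, hence at most
  \<open>\<zeta>(u)\<close>. The bound is linear in \<open>1 / (u - 1)\<close>, which is decisive
  when \<open>u\<close> tends to 1.\<close>

lemma prod_one_plus_prime_powr_le:
  fixes u :: real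
  assumes u: "u > 1" and P: "finite P" "\<And>p. p \<in> P \<Longrightarrow> prime (p::nat)"
  shows "(\<Prod>p\<in>P. 1 + real p powr (- u)) \<le> 1 + 1 / (u - 1)"
proof -
  have "(\<Prod>p\<in>P. 1 + real p powr (- u)) = (\<Prod>p\<in>P. real p powr (- u) + 1)"
    by (simp add: add.commute)
  also have "\<dots> = (\<Sum>S\<in>Pow P. (\<Prod>p\<in>S. real p powr (- u)) * (\<Prod>p\<in>P - S. 1))"
    by (rule prod_add) (rule P)
  also have "\<dots> = (\<Sum>S\<in>Pow P. real (\<Prod>p\<in>S. p) powr (- u))"
    by (intro sum.cong refl) (auto simp: prod_powr_distrib)
  also have "\<dots> = (\<Sum>n\<in>(\<lambda>S. \<Prod>p\<in>S. p) ` Pow P. real n powr (- u))"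
    by (subst sum.reindex) (use inj_on_prod_primes [OF P] in auto)
  also have "\<dots> \<le> 1 + 1 / (u - 1)"
  proof (rule sum_powr_le [OF u])
    show "0 \<notin> (\<lambda>S. \<Prod>p\<in>S. p) ` Pow P"
    proof
      assume "0 \<in> (\<lambda>S. \<Prod>p\<in>S. p) ` Pow P"
      then obtain S where "S \<subseteq> P" "(\<Prod>p\<in>S. p) = 0"
        by auto
      then have "0 \<in> P"
        using P(1) by (metis finite_subset prod_zero_iff subset_iff)
      with P(2) show False
        using not_prime_0 by blast
    qed
  qed (use P in auto)
  finally show ?thesis .
qed

text \<open>A crude companion, with a coefficient \<open>C\<close>, for exponents \<open>u\<close>
  that stay fixed: there the exponential dependence on \<open>1 / (u - 1)\<close> does no
  harm.\<close>

lemma prod_one_plus_le_exp: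
  fixes u C :: real
  assumes u: "u > 1" and C: "C \<ge> 0" and F: "finite F" "0 \<notin> F"
  shows "(\<Prod>n\<in>F. 1 + C * real n powr (- u)) \<le> exp (C * (1 + 1 / (u - 1)))"
proof -
  have "(\<Prod>n\<in>F. 1 + C * real n powr (- u)) \<le> exp (\<Sum>n\<in>F. C * real n powr (- u))"
    using C by (intro prod_le_exp_sum) auto
  also have "\<dots> = exp (C * (\<Sum>n\<in>F. real n powr (- u)))"
    by (simp add: sum_distrib_left)
  also have "\<dots> \<le> exp (C * (1 + 1 / (u - 1)))"
    using sum_powr_le [OF u F] C by (simp add: mult_left_mono)
  finally show ?thesis .
qed

definition primes_le :: "nat \<Rightarrow> nat set" where
  "primes_le N = {p. prime p \<and> p \<le> N}"

lemma finite_primes_le [simp]: "finite (primes_le N)"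
  unfolding primes_le_def by (rule finite_subset [of _ "{..N}"]) auto

lemma local_series_nonneg: "local_series r K N i s p \<ge> 0"
  by (auto simp: local_series_def intro!: sum_nonneg)

text \<open>Bernoulli's inequality replaces \<open>1 + (card K - 1) * t\<close> by
  \<open>(1 + t) ^ (card K - 1)\<close>, which brings the singular part of each factor into the form
  of the squarefree product. The part of order \<open>p powr (- 2)\<close> multiplies to a constant
  that depends neither on \<open>s\<close> nor on \<open>N\<close>.\<close>

lemma prod_local_series_le_nonneg:
  assumes K: "finite K" "i \<in> K" and r: "r \<ge> 0"
  shows "\<exists>C>0. \<forall>s N. 0 \<le> s \<longrightarrow> s < 1 \<longrightarrow>
    (\<Prod>p\<in>primes_le N. local_series r K N i s p) \<le> C * (1 + 1 / (1 - s)) ^ (card K - 1)"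
proof -
  define C where "C = 4 * 2 ^ card K * (1 / (1 - 2 powr (-1/2 :: real))) ^ card K"
  have "(2::real) powr (-1/2) < 2 powr 0"
    by (intro powr_less_mono) auto
  then have C: "C \<ge> 0"
    by (simp add: C_def)
  show ?thesis
  proof (intro exI conjI allI impI)
    fix s :: real and N :: nat assume s: "0 \<le> s" "s < 1"
    have pos: "p > 0" "p \<ge> 2" "prime p" if "p \<in> primes_le N" for p
      using that prime_ge_2_nat [of p] by (auto simp: primes_le_def)
    have "(\<Prod>p\<in>primes_le N. local_series r K N i s p) \<le>
        (\<Prod>p\<in>primes_le N. (1 + real p powr (- (2 - s))) ^ (card K - 1) * (1 + C * real p powr (-2)))"
    proof (intro prod_mono conjI local_series_nonneg)
      fix p assume p: "p \<in> primes_le N"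
      have "local_series r K N i s p \<le> 1 + real (card K - 1) * real p powr (s - 2) + C * real p powr (-2)"
        unfolding C_def using pos(2) [OF p] s by (intro local_series_le_nonneg K r) auto
      also have "\<dots> \<le> (1 + real (card K - 1) * real p powr (s - 2)) * (1 + C * real p powr (-2))"
        using C by (simp add: algebra_simps)
      also have "\<dots> \<le> (1 + real p powr (s - 2)) ^ (card K - 1) * (1 + C * real p powr (-2))"
        using C Bernoulli_inequality [of "real p powr (s - 2)" "card K - 1"]
        by (intro mult_right_mono) (auto simp: order_trans [of _ 0])
      finally show "local_series r K N i s p \<le>
          (1 + real p powr (- (2 - s))) ^ (card K - 1) * (1 + C * real p powr (-2))"
        by simp
    qed
    also have "\<dots> = (\<Prod>p\<in>primes_le N. 1 + real p powr (- (2 - s))) ^ (card K - 1) *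
        (\<Prod>p\<in>primes_le N. 1 + C * real p powr (-2))"
      by (simp add: prod.distrib prod_power_distrib)
    also have "\<dots> \<le> (1 + 1 / (2 - s - 1)) ^ (card K - 1) * exp (C * (1 + 1 / (2 - 1)))"
      using s pos C
      by (intro mult_mono power_mono prod_one_plus_prime_powr_le prod_one_plus_le_exp prod_nonneg) auto
    also have "\<dots> = exp (2 * C) * (1 + 1 / (1 - s)) ^ (card K - 1)"
      by (simp add: mult_ac)
    finally show "(\<Prod>p\<in>primes_le N. local_series r K N i s p) \<le>
        exp (2 * C) * (1 + 1 / (1 - s)) ^ (card K - 1)" .
  qed simp
qed

lemma prod_local_series_le_nonpos:
  assumes K: "finite K" "i \<in> K" and r: "-1 < r" "r \<le> 0"
  shows "\<exists>C>0. \<forall>N. (\<Prod>p\<in>primes_le N. local_series r K N i ((1 + r) / 2) p) \<le> C"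
proof -
  define s where "s = (1 + r) / 2"
  have s: "s > 0"
    using r by (simp add: s_def)
  define C where "C = 2 ^ card K * (1 / (1 - 2 powr (- s / 4))) ^ card K"
  have "(2::real) powr (- s / 4) < 2 powr 0"
    using s by (intro powr_less_mono) auto
  then have C: "C \<ge> 0"
    by (simp add: C_def)
  show ?thesis
    unfolding s_def [symmetric]
  proof (intro exI conjI allI)
    fix N :: nat
    have pos: "p > 0" "p \<ge> 2" if "p \<in> primes_le N" for p
      using that prime_ge_2_nat [of p] by (auto simp: primes_le_def)
    have "(\<Prod>p\<in>primes_le N. local_series r K N i s p) \<le>
        (\<Prod>p\<in>primes_le N. 1 + C * real p powr (- (1 + s / 2)))"
    proof (intro prod_mono conjI local_series_nonneg)
      fix p assume p: "p \<in> primes_le N"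
      show "local_series r K N i s p \<le> 1 + C * real p powr (- (1 + s / 2))"
        using local_series_le_nonpos [OF K r pos(2) [OF p], of N] by (simp add: C_def s_def)
    qed
    also have "\<dots> \<le> exp (C * (1 + 1 / (1 + s / 2 - 1)))"
      using s pos C by (intro prod_one_plus_le_exp) auto
    finally show "(\<Prod>p\<in>primes_le N. local_series r K N i s p) \<le> exp (C * (1 + 1 / (1 + s / 2 - 1)))" .
  qed simp
qed

subsection \<open>Means over multiples\<close>

text \<open>Both bounds are integrals from 0, to \<open>n + 1\<close> and to \<open>n + 2\<close>.
  Thus the sum and \<open>y powr (\<rho> + 1) / (\<rho> + 1)\<close>, for \<open>y\<close> between
  these ends, lie in the same interval.\<close>

lemma sum_powr_bounds_nonneg:
  fixes \<rho> :: real
  assumes "\<rho> \<ge> 0"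
  shows "real (Suc n) powr (\<rho> + 1) / (\<rho> + 1) \<le> (\<Sum>m=1..Suc n. real m powr \<rho>)" (is "?A n")
    and "(\<Sum>m=1..Suc n. real m powr \<rho>) \<le> real (Suc (Suc n)) powr (\<rho> + 1) / (\<rho> + 1)" (is "?B n")
proof -
  have step: "real (Suc n) powr \<rho> \<le> (real (Suc (Suc n)) powr (\<rho> + 1) - real (Suc n) powr (\<rho> + 1)) / (\<rho> + 1)"
      "(real (Suc (Suc n)) powr (\<rho> + 1) - real (Suc n) powr (\<rho> + 1)) / (\<rho> + 1) \<le> real (Suc (Suc n)) powr \<rho>" for n
  proof -
    obtain \<xi> where \<xi>: "real (Suc n) < \<xi>" "\<xi> < real (Suc n) + 1"
        "(real (Suc n) + 1) powr (\<rho> + 1) - real (Suc n) powr (\<rho> + 1) = (\<rho> + 1) * \<xi> powr (\<rho> + 1 - 1)"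
      using powr_Suc_diff_mvt [of "real (Suc n)" "\<rho> + 1"] by auto
    then have eq: "(real (Suc (Suc n)) powr (\<rho> + 1) - real (Suc n) powr (\<rho> + 1)) / (\<rho> + 1) = \<xi> powr \<rho>"
      using assms by (simp add: add.commute)
    show "real (Suc n) powr \<rho> \<le> (real (Suc (Suc n)) powr (\<rho> + 1) - real (Suc n) powr (\<rho> + 1)) / (\<rho> + 1)"
      unfolding eq using \<xi> assms by (intro powr_mono2) auto
    show "(real (Suc (Suc n)) powr (\<rho> + 1) - real (Suc n) powr (\<rho> + 1)) / (\<rho> + 1) \<le> real (Suc (Suc n)) powr \<rho>"
      unfolding eq using \<xi> assms by (intro powr_mono2) auto
  qed
  show "?A n"
  proof (induction n)
    case (Suc n)
    then show ?case
      using step(2) [of n] by (simp add: diff_divide_distrib)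
  qed (use assms in \<open>auto simp: field_simps\<close>)
  show "?B n"
  proof (induction n)
    case 0
    have "0 \<le> 1 / (\<rho> + 1)"
      using assms by simp
    moreover have "1 \<le> real (Suc (Suc 0)) powr (\<rho> + 1) / (\<rho> + 1) - 1 / (\<rho> + 1)"
      using step(1) [of 0] by (simp add: diff_divide_distrib)
    ultimately have "1 \<le> real (Suc (Suc 0)) powr (\<rho> + 1) / (\<rho> + 1)"
      by linarith
    then show ?case
      by simp
  next
    case (Suc n)
    then show ?case
      using step(1) [of "Suc n"] by (simp add: diff_divide_distrib)
  qed
qed

text \<open>For a decreasing power the upper bound is the integral from 0 to \<open>n + 1\<close>
  and the lower one the integral from 1 to \<open>n + 2\<close>; the piece over
  \<open>[0, 1]\<close> accounts for \<open>1 / (\<rho> + 1)\<close>.\<close>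

lemma sum_powr_bounds_neg:
  fixes \<rho> :: real
  assumes "-1 < \<rho>" "\<rho> < 0"
  shows "(\<Sum>m=1..Suc n. real m powr \<rho>) \<le> real (Suc n) powr (\<rho> + 1) / (\<rho> + 1)" (is "?A n")
    and "(real (Suc (Suc n)) powr (\<rho> + 1) - 1) / (\<rho> + 1) \<le> (\<Sum>m=1..Suc n. real m powr \<rho>)" (is "?B n")
proof -
  have step: "real (Suc (Suc n)) powr \<rho> \<le> (real (Suc (Suc n)) powr (\<rho> + 1) - real (Suc n) powr (\<rho> + 1)) / (\<rho> + 1)"
      "(real (Suc (Suc n)) powr (\<rho> + 1) - real (Suc n) powr (\<rho> + 1)) / (\<rho> + 1) \<le> real (Suc n) powr \<rho>" for n
  proof -
    obtain \<xi> where \<xi>: "real (Suc n) < \<xi>" "\<xi> < real (Suc n) + 1"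
        "(real (Suc n) + 1) powr (\<rho> + 1) - real (Suc n) powr (\<rho> + 1) = (\<rho> + 1) * \<xi> powr (\<rho> + 1 - 1)"
      using powr_Suc_diff_mvt [of "real (Suc n)" "\<rho> + 1"] by auto
    then have eq: "(real (Suc (Suc n)) powr (\<rho> + 1) - real (Suc n) powr (\<rho> + 1)) / (\<rho> + 1) = \<xi> powr \<rho>"
      using assms by (simp add: add.commute)
    show "real (Suc (Suc n)) powr \<rho> \<le> (real (Suc (Suc n)) powr (\<rho> + 1) - real (Suc n) powr (\<rho> + 1)) / (\<rho> + 1)"
      unfolding eq using \<xi> assms by (intro powr_mono2') auto
    show "(real (Suc (Suc n)) powr (\<rho> + 1) - real (Suc n) powr (\<rho> + 1)) / (\<rho> + 1) \<le> real (Suc n) powr \<rho>"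
      unfolding eq using \<xi> assms by (intro powr_mono2') auto
  qed
  show "?A n"
  proof (induction n)
    case (Suc n)
    then show ?case
      using step(1) [of n] by (simp add: diff_divide_distrib)
  qed (use assms in \<open>auto simp: field_simps\<close>)
  show "?B n"
  proof (induction n)
    case 0
    show ?case
      using step(2) [of 0] by simp
  next
    case (Suc n)
    then show ?case
      using step(2) [of "Suc n"] by (simp add: diff_divide_distrib)
  qed
qed

text \<open>For \<open>\<rho> \<ge> 0\<close> the common interval has length
  \<open>\<xi> powr \<rho>\<close> with \<open>\<xi> < n + 2 \<le> 2 * y\<close>, the origin of
  \<open>2 powr \<rho>\<close>. For \<open>\<rho> < 0\<close> the error is at most the integral over
  \<open>[0, 1]\<close>.\<close>

lemma sum_powr_approx:
  fixes \<rho> y :: real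
  assumes \<rho>: "\<rho> > -1" and n: "real (Suc n) \<le> y" "y \<le> real (Suc (Suc n))"
  shows "\<bar>(\<Sum>m=1..Suc n. real m powr \<rho>) - y powr (\<rho> + 1) / (\<rho> + 1)\<bar> \<le>
    (2 powr \<rho> + 1 / (\<rho> + 1)) * y powr (max \<rho> 0)"
proof (cases "\<rho> \<ge> 0")
  case True
  let ?a = "real (Suc n) powr (\<rho> + 1) / (\<rho> + 1)" and ?b = "real (Suc (Suc n)) powr (\<rho> + 1) / (\<rho> + 1)"
  obtain \<xi> where \<xi>: "real (Suc n) < \<xi>" "\<xi> < real (Suc n) + 1"
      "(real (Suc n) + 1) powr (\<rho> + 1) - real (Suc n) powr (\<rho> + 1) = (\<rho> + 1) * \<xi> powr (\<rho> + 1 - 1)"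
    using powr_Suc_diff_mvt [of "real (Suc n)" "\<rho> + 1"] by auto
  then have "?b - ?a = \<xi> powr \<rho>"
    using \<rho> by (simp add: add.commute diff_divide_distrib [symmetric])
  also have "\<dots> \<le> (2 * y) powr \<rho>"
    using \<xi> n True by (intro powr_mono2) auto
  also have "\<dots> = 2 powr \<rho> * y powr \<rho>"
    using n by (simp add: powr_mult)
  also have "\<dots> \<le> (2 powr \<rho> + 1 / (\<rho> + 1)) * y powr \<rho>"
    using \<rho> by (intro mult_right_mono) auto
  finally have ab: "?b - ?a \<le> (2 powr \<rho> + 1 / (\<rho> + 1)) * y powr (max \<rho> 0)"
    using True by (simp add: max_def)
  have "?a \<le> y powr (\<rho> + 1) / (\<rho> + 1)" "y powr (\<rho> + 1) / (\<rho> + 1) \<le> ?b"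
    using n \<rho> by (intro divide_right_mono powr_mono2; simp)+
  then show ?thesis
    using sum_powr_bounds_nonneg [OF True, of n] ab by linarith
next
  case False
  have "real (Suc n) powr (\<rho> + 1) / (\<rho> + 1) \<le> y powr (\<rho> + 1) / (\<rho> + 1)"
       "(y powr (\<rho> + 1) - 1) / (\<rho> + 1) \<le> (real (Suc (Suc n)) powr (\<rho> + 1) - 1) / (\<rho> + 1)"
    using n \<rho> by (intro divide_right_mono powr_mono2 diff_right_mono; simp)+
  then have "\<bar>(\<Sum>m=1..Suc n. real m powr \<rho>) - y powr (\<rho> + 1) / (\<rho> + 1)\<bar> \<le> 1 / (\<rho> + 1)"
    using sum_powr_bounds_neg [of \<rho> n] False \<rho> by (simp add: diff_divide_distrib)
  also have "\<dots> \<le> 2 powr \<rho> + 1 / (\<rho> + 1)"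
    by simp
  finally show ?thesis
    using False n by (simp add: max_def)
qed

text \<open>This is \<open>A(d)\<close> of the overview.\<close>

definition dvd_mean :: "real \<Rightarrow> nat \<Rightarrow> nat \<Rightarrow> real" where
  "dvd_mean \<rho> x d = (\<Sum>n\<in>{1..x}. of_bool (d dvd n) * (real n / real x) powr \<rho>) / real x"

lemma dvd_mean_eq:
  assumes "x \<ge> 1" "d \<ge> 1"
  shows "real d * dvd_mean \<rho> x d =
    (real d / real x) powr (\<rho> + 1) * (\<Sum>m=1..x div d. real m powr \<rho>)"
proof -
  have "(\<Sum>n\<in>{1..x}. of_bool (d dvd n) * (real n / real x) powr \<rho>) =
      (\<Sum>n\<in>{n\<in>{1..x}. d dvd n}. (real n / real x) powr \<rho>)"
    by (rule sum.mono_neutral_cong_right) auto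
  also have "\<dots> = (\<Sum>m=1..x div d. (real (d * m) / real x) powr \<rho>)"
  proof (rule sum.reindex_cong [of "\<lambda>m. d * m"])
    show "{n \<in> {1..x}. d dvd n} = (*) d ` {1..x div d}"
      using assms by (auto simp: less_eq_div_iff_mult_less_eq mult.commute elim!: dvdE)
  qed (use assms in \<open>auto simp: inj_on_def\<close>)
  also have "\<dots> = (\<Sum>m=1..x div d. (real d / real x) powr \<rho> * real m powr \<rho>)"
    by (intro sum.cong refl, subst powr_mult [symmetric]) (auto simp: field_simps)
  finally show ?thesis
    using assms unfolding dvd_mean_def
    by (simp add: sum_distrib_left [symmetric] powr_add)
qed

text \<open>With \<open>y = x / d\<close> the error is
  \<open>O(y powr (- min 1 (1 + \<rho>)))\<close>, hence the two upper bounds on \<open>s\<close>.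
  If \<open>d > x\<close>, the mean is 0 and the main term itself is absorbed, because
  \<open>d / x > 1\<close>.\<close>

lemma dvd_mean_approx:
  fixes \<rho> :: real
  assumes \<rho>: "\<rho> > -1"
  shows "\<exists>C\<ge>1. 1 / (\<rho> + 1) \<le> C \<and> (\<forall>x d s. x \<ge> 1 \<longrightarrow> d \<ge> 1 \<longrightarrow> 0 \<le> s \<longrightarrow> s \<le> 1 \<longrightarrow> s \<le> 1 + \<rho> \<longrightarrow>
    \<bar>real d * dvd_mean \<rho> x d\<bar> \<le> C \<and>
    \<bar>real d * dvd_mean \<rho> x d - 1 / (\<rho> + 1)\<bar> \<le> C * (real d / real x) powr s)"
proof -
  define C0 where "C0 = 2 powr \<rho> + 1 / (\<rho> + 1)"
  have C0: "C0 \<ge> 1 / (\<rho> + 1)" "1 / (\<rho> + 1) > 0" "C0 \<ge> 0"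
    using \<rho> by (auto simp: C0_def)
  have *: "\<bar>real d * dvd_mean \<rho> x d - 1 / (\<rho> + 1)\<bar> \<le> C0 * (real d / real x) powr s"
    if x: "x \<ge> 1" "d \<ge> 1" "0 \<le> s" "s \<le> 1" "s \<le> 1 + \<rho>" for x d s
  proof (cases "d \<le> x")
    case True
    define y where "y = real x / real d"
    have y: "y \<ge> 1" "real d / real x = inverse y"
      using True x by (auto simp: y_def field_simps)
    obtain n where n: "x div d = Suc n"
      using True x by (metis Suc_le_D div_greater_zero_iff Suc_leI One_nat_def gr0_implies_Suc zero_less_one order_less_le_trans)
    have "d * Suc n \<le> x" "x < d * Suc (Suc n)"
      using x n times_div_less_eq_dividend [of d x] dividend_less_times_div [of d x] by auto
    then have yn: "real (Suc n) \<le> y" "y \<le> real (Suc (Suc n))"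
      using x unfolding y_def by (auto simp: field_simps simp flip: of_nat_mult of_nat_add of_nat_Suc)
    have "real d * dvd_mean \<rho> x d - 1 / (\<rho> + 1) = y powr (- \<rho> - 1) *
        ((\<Sum>m=1..Suc n. real m powr \<rho>) - y powr (\<rho> + 1) / (\<rho> + 1))"
      using x y by (simp add: dvd_mean_eq n right_diff_distrib powr_add [symmetric] inverse_powr powr_minus [symmetric])
    also have "\<bar>\<dots>\<bar> \<le> y powr (- \<rho> - 1) * (C0 * y powr (max \<rho> 0))"
      unfolding abs_mult C0_def
      using sum_powr_approx [OF \<rho> yn] by (intro mult_mono) auto
    also have "\<dots> = C0 * y powr (- \<rho> - 1 + max \<rho> 0)"
      by (simp add: powr_add)
    also have "\<dots> \<le> C0 * y powr (- s)"
      using C0 y x by (intro mult_left_mono powr_mono) auto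
    also have "y powr (- s) = (real d / real x) powr s"
      using y by (simp add: powr_minus inverse_powr)
    finally show ?thesis .
  next
    case False
    then have "real d * dvd_mean \<rho> x d = 0"
      using x by (simp add: dvd_mean_eq)
    moreover have "1 \<le> (real d / real x) powr s"
      using False x by (intro ge_one_powr_ge_zero) auto
    ultimately show ?thesis
      using C0 mult_mono [of "1 / (\<rho> + 1)" C0 1 "(real d / real x) powr s"] by auto
  qed
  \<comment> \<open>The uniform bound comes from the error estimate at \<open>s = 0\<close>, where
    the power of \<open>d / x\<close> is 1.\<close>
  have **: "\<bar>real d * dvd_mean \<rho> x d\<bar> \<le> C0 + 1 / (\<rho> + 1)" if "x \<ge> 1" "d \<ge> 1" for x d
  proof -
    have "\<bar>real d * dvd_mean \<rho> x d - 1 / (\<rho> + 1)\<bar> \<le> C0 * (real d / real x) powr 0"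
      using that \<rho> by (intro *) auto
    also have "\<dots> = C0"
      using that by simp
    finally show ?thesis
      using C0 by linarith
  qed
  show ?thesis
  proof (intro exI conjI allI impI)
    fix x d :: nat and s :: real
    assume x: "x \<ge> 1" "d \<ge> 1" "0 \<le> s" "s \<le> 1" "s \<le> 1 + \<rho>"
    \<comment> \<open>The added 1 provides \<open>C \<ge> 1\<close>, as
      \<open>abs_prod_diff_le\<close> asks.\<close>
    show "\<bar>real d * dvd_mean \<rho> x d\<bar> \<le> C0 + 1 / (\<rho> + 1) + 1"
      using ** [of x d] x by simp
    have "C0 * (real d / real x) powr s \<le> (C0 + 1 / (\<rho> + 1) + 1) * (real d / real x) powr s"
      using C0 by (intro mult_right_mono) auto
    then show "\<bar>real d * dvd_mean \<rho> x d - 1 / (\<rho> + 1)\<bar> \<le> (C0 + 1 / (\<rho> + 1) + 1) * (real d / real x) powr s"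
      using * [OF x] by linarith
  qed (use C0 in auto)
qed

subsection \<open>Weighted averages\<close>

text \<open>A tuple \<open>d\<close> is encoded by its exponents \<open>e p j\<close> at the primes
  up to \<open>N\<close>, so that \<open>diff_coeff\<close> is \<open>g(d)\<close> and
  \<open>smooth_part\<close> is \<open>d_j\<close>. Sums over \<open>d\<close> become finite sums
  over functions on the primes and factor by \<open>prod_sum_PiE\<close>.\<close>

definition exponent_families :: "'i set \<Rightarrow> nat \<Rightarrow> (nat \<Rightarrow> 'i \<Rightarrow> nat) set" where
  "exponent_families K N = primes_le N \<rightarrow>\<^sub>E (K \<rightarrow>\<^sub>E {..N})"

definition diff_coeff :: "real \<Rightarrow> 'i set \<Rightarrow> nat \<Rightarrow> (nat \<Rightarrow> 'i \<Rightarrow> nat) \<Rightarrow> real" where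
  "diff_coeff r K N e = (\<Prod>p\<in>primes_le N. mixed_diff K N (lcm_local r K p) (e p))"

definition smooth_part :: "nat \<Rightarrow> (nat \<Rightarrow> 'i \<Rightarrow> nat) \<Rightarrow> 'i \<Rightarrow> nat" where
  "smooth_part N e j = (\<Prod>p\<in>primes_le N. p ^ e p j)"

lemma finite_exponent_families [simp]: "finite K \<Longrightarrow> finite (exponent_families K N)"
  by (auto simp: exponent_families_def intro!: finite_PiE)

lemma smooth_part_pos: "smooth_part N e j > 0"
  by (auto simp: smooth_part_def primes_le_def prime_gt_0_nat intro!: prod_pos)

text \<open>Inversion at every prime, multiplied out. The exponents \<open>v\<close> are arbitrary
  up to \<open>N\<close>: multiplicities of integers lead to the averages, truncated geometric
  variables to the expectation.\<close>

lemma prod_lcm_local_expand: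
  assumes K: "finite K" and v: "\<And>p j. p \<in> primes_le N \<Longrightarrow> j \<in> K \<Longrightarrow> v p j \<le> N"
  shows "(\<Prod>p\<in>primes_le N. lcm_local r K p (v p)) =
    (\<Sum>e\<in>exponent_families K N. diff_coeff r K N e * of_bool (\<forall>j\<in>K. \<forall>p\<in>primes_le N. e p j \<le> v p j))"
proof -
  have "(\<Prod>p\<in>primes_le N. lcm_local r K p (v p)) =
      (\<Prod>p\<in>primes_le N. \<Sum>a\<in>K \<rightarrow>\<^sub>E {..N}. of_bool (\<forall>j\<in>K. a j \<le> v p j) * mixed_diff K N (lcm_local r K p) a)"
  proof (rule prod.cong [OF refl])
    fix p assume p: "p \<in> primes_le N"
    have "lcm_local r K p (v p) = lcm_local r K p (restrict (v p) K)"
      by (rule lcm_local_cong) simp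
    also have "\<dots> = (\<Sum>a\<in>K \<rightarrow>\<^sub>E {..N}. of_bool (\<forall>j\<in>K. a j \<le> restrict (v p) K j) * mixed_diff K N (lcm_local r K p) a)"
      using v [OF p] by (intro sum_mixed_diff [symmetric] K) auto
    finally show "lcm_local r K p (v p) =
        (\<Sum>a\<in>K \<rightarrow>\<^sub>E {..N}. of_bool (\<forall>j\<in>K. a j \<le> v p j) * mixed_diff K N (lcm_local r K p) a)"
      by simp
  qed
  also have "\<dots> = (\<Sum>e\<in>exponent_families K N. \<Prod>p\<in>primes_le N.
      of_bool (\<forall>j\<in>K. e p j \<le> v p j) * mixed_diff K N (lcm_local r K p) (e p))"
    unfolding exponent_families_def using K by (subst prod_sum_PiE) (auto intro!: finite_PiE)
  also have "\<dots> = (\<Sum>e\<in>exponent_families K N. diff_coeff r K N e *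
      of_bool (\<forall>p\<in>primes_le N. \<forall>j\<in>K. e p j \<le> v p j))"
    by (simp add: prod.distrib diff_coeff_def of_bool_Ball [of "primes_le N"] mult.commute)
  also have "\<dots> = (\<Sum>e\<in>exponent_families K N. diff_coeff r K N e *
      of_bool (\<forall>j\<in>K. \<forall>p\<in>primes_le N. e p j \<le> v p j))"
    by (intro sum.cong refl arg_cong2 [of _ _ _ _ "(*)"] arg_cong [of _ _ of_bool]) blast
  finally show ?thesis .
qed

lemma smooth_part_dvd_iff:
  assumes "n > 0"
  shows "smooth_part N e j dvd n \<longleftrightarrow> (\<forall>p\<in>primes_le N. e p j \<le> multiplicity p n)"
proof -
  have mult: "multiplicity p (smooth_part N e j) = (if p \<in> primes_le N then e p j else 0)" if "prime p" for p
    unfolding smooth_part_def using that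
    by (intro multiplicity_prod_prime_powers) (auto simp: primes_le_def)
  show ?thesis
  proof
    assume dvd: "smooth_part N e j dvd n"
    show "\<forall>p\<in>primes_le N. e p j \<le> multiplicity p n"
    proof
      fix p assume p: "p \<in> primes_le N"
      then have "e p j = multiplicity p (smooth_part N e j)"
        using mult [of p] by (simp add: primes_le_def)
      also have "\<dots> \<le> multiplicity p n"
        using dvd assms by (intro dvd_imp_multiplicity_le) auto
      finally show "e p j \<le> multiplicity p n" .
    qed
  next
    assume le: "\<forall>p\<in>primes_le N. e p j \<le> multiplicity p n"
    show "smooth_part N e j dvd n"
    proof (rule multiplicity_le_imp_dvd)
      fix p :: nat assume "prime p"
      then show "multiplicity p (smooth_part N e j) \<le> multiplicity p n"
        using mult [of p] le by simp
    qed (use smooth_part_pos [of N e j] in simp)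
  qed
qed

lemma prod_primes_le_multiplicity:
  assumes "n > 0" "\<And>p. prime p \<Longrightarrow> p dvd n \<Longrightarrow> p \<le> N"
  shows "n = (\<Prod>p\<in>primes_le N. p ^ multiplicity p n)"
proof -
  have "n = (\<Prod>p\<in>prime_factors n. p ^ multiplicity p n)"
    using assms(1) prime_factorization_nat by auto
  also have "\<dots> = (\<Prod>p\<in>primes_le N. p ^ multiplicity p n)"
    by (rule prod.mono_neutral_left)
       (use assms in \<open>auto simp: primes_le_def prime_factors_dvd not_dvd_imp_multiplicity_0\<close>)
  finally show ?thesis .
qed

section \<open>Prime exponents of least common multiples and products\<close>

lemma multiplicity_Lcm:
  assumes "finite K" "K \<noteq> {}" "\<And>j. j \<in> K \<Longrightarrow> n j > (0::nat)" "prime p"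
  shows "multiplicity p (LCM j\<in>K. n j) = (MAX j\<in>K. multiplicity p (n j))"
  using assms
proof (induction K rule: finite_ne_induct)
  case (insert i K)
  have "0 \<notin> n ` K"
    using insert.prems(1) by (metis image_iff insertCI less_irrefl)
  then have "(LCM j\<in>K. n j) \<noteq> 0"
    using insert.hyps by (subst Lcm_0_iff) auto
  with insert show ?case
    by (simp add: multiplicity_lcm)
qed simp

lemma multiplicity_prod_nat:
  assumes "finite K" "\<And>j. j \<in> K \<Longrightarrow> n j > (0::nat)" "prime p"
  shows "multiplicity p (\<Prod>j\<in>K. n j) = (\<Sum>j\<in>K. multiplicity p (n j))"
  using assms
proof (induction K rule: finite_induct)
  case (insert i K)
  then show ?case
    by (simp add: prime_elem_multiplicity_mult_distrib prod_pos)
qed simp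

text \<open>A power \<open>p ^ m\<close> exceeds \<open>m\<close>. Thus for integers up to
  \<open>N\<close>, cutting the exponents at \<open>N\<close> loses nothing.\<close>

lemma multiplicity_le_self: "n > 0 \<Longrightarrow> prime p \<Longrightarrow> multiplicity p n \<le> (n::nat)"
  by (metis dvd_imp_le le_trans less_imp_le multiplicity_dvd power_gt_expt prime_gt_Suc_0_nat)

lemma lcm_ratio_powr_eq:
  assumes K: "finite K" "K \<noteq> {}" and n: "\<And>j. j \<in> K \<Longrightarrow> n j \<in> {1..N}"
  shows "(real (LCM j\<in>K. n j) / real (\<Prod>j\<in>K. n j)) powr r =
    (\<Prod>p\<in>primes_le N. lcm_local r K p (\<lambda>j. multiplicity p (n j)))"
proof -
  have pos: "n j > 0" if "j \<in> K" for j
    using n [OF that] by simp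
  have P: "real p > 0" "p \<noteq> 0" if "p \<in> primes_le N" for p
    using that by (auto simp: primes_le_def prime_gt_0_nat)
  have nz_prod: "(\<Prod>j\<in>K. n j) > 0"
    using pos by (auto intro!: prod_pos)
  have dvd: "p \<le> N" if "prime p" "p dvd (\<Prod>j\<in>K. n j)" for p
  proof -
    have "\<exists>j\<in>K. p dvd n j"
      using that K by (simp only: prime_dvd_prod_iff)
    then obtain j where "j \<in> K" "p dvd n j"
      by blast
    then show ?thesis
      using n [of j] dvd_imp_le [of p "n j"] by auto
  qed
  have dvd_prod: "(LCM j\<in>K. n j) dvd (\<Prod>j\<in>K. n j)"
    using K by (auto intro!: Lcm_least dvd_prodI)
  have nz: "(LCM j\<in>K. n j) > 0" "(\<Prod>j\<in>K. n j) > 0"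
    using dvd_pos_nat [OF nz_prod dvd_prod] nz_prod by auto
  define L where "L = (LCM j\<in>K. n j)"
  define Q where "Q = (\<Prod>j\<in>K. n j)"
  have "L = (\<Prod>p\<in>primes_le N. p ^ multiplicity p L)" "Q = (\<Prod>p\<in>primes_le N. p ^ multiplicity p Q)"
    using nz dvd dvd_trans [OF _ dvd_prod] unfolding L_def Q_def
    by (intro prod_primes_le_multiplicity; blast)+
  then have "real L = (\<Prod>p\<in>primes_le N. real p ^ multiplicity p L)"
      "real Q = (\<Prod>p\<in>primes_le N. real p ^ multiplicity p Q)"
    by (metis (no_types, lifting) of_nat_power of_nat_prod prod.cong)+
  then have "real L / real Q = (\<Prod>p\<in>primes_le N. real p ^ multiplicity p L / real p ^ multiplicity p Q)"
    by (simp only: prod_dividef)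
  also have "\<dots> = (\<Prod>p\<in>primes_le N. real p powr
      (real (MAX j\<in>K. multiplicity p (n j)) - real (\<Sum>j\<in>K. multiplicity p (n j))))"
  proof (rule prod.cong [OF refl])
    fix p assume p: "p \<in> primes_le N"
    then have "prime p"
      by (simp add: primes_le_def)
    then have "multiplicity p L = (MAX j\<in>K. multiplicity p (n j))"
        "multiplicity p Q = (\<Sum>j\<in>K. multiplicity p (n j))"
      unfolding L_def Q_def using multiplicity_Lcm [of K n p] multiplicity_prod_nat [of K n p] K pos by blast+
    moreover have "real p ^ A / real p ^ B = real p powr (real A - real B)" for A B
      using P [OF p] by (simp add: powr_diff powr_realpow)
    ultimately show "real p ^ multiplicity p L / real p ^ multiplicity p Q =
        real p powr (real (MAX j\<in>K. multiplicity p (n j)) - real (\<Sum>j\<in>K. multiplicity p (n j)))"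
      by simp
  qed
  finally have "real (LCM j\<in>K. n j) / real (\<Prod>j\<in>K. n j) = (\<Prod>p\<in>primes_le N. real p powr
      (real (MAX j\<in>K. multiplicity p (n j)) - real (\<Sum>j\<in>K. multiplicity p (n j))))"
    unfolding L_def Q_def .
  then have "(real (LCM j\<in>K. n j) / real (\<Prod>j\<in>K. n j)) powr r =
      (\<Prod>p\<in>primes_le N. (real p powr
        (real (MAX j\<in>K. multiplicity p (n j)) - real (\<Sum>j\<in>K. multiplicity p (n j)))) powr r)"
    by (simp only: prod_powr_distrib [symmetric] powr_ge_zero)
  then show ?thesis
    by (simp add: lcm_local_def powr_powr mult.commute del: of_nat_sum)
qed

text \<open>The exponent \<open>\<rho>\<close> unites the two averages: \<open>\<rho> = r\<close>
  gives the one normalised by \<open>x ^ k\<close>, since the powers of \<open>n j\<close> cancel,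
  and \<open>\<rho> = 0\<close> the other.\<close>

definition weighted_avg :: "real \<Rightarrow> real \<Rightarrow> 'i set \<Rightarrow> nat \<Rightarrow> real" where
  "weighted_avg r \<rho> K x = 1 / real x ^ card K *
     (\<Sum>n\<in>K \<rightarrow>\<^sub>E {1..x}. (real (LCM j\<in>K. n j) / real (\<Prod>j\<in>K. n j)) powr r * (\<Prod>j\<in>K. (real (n j) / real x) powr \<rho>))"

text \<open>Exact for every \<open>N \<ge> x\<close>, as no \<open>n j \<le> x\<close> has a prime
  factor or an exponent beyond \<open>N\<close>. This leaves \<open>N\<close> free to tend to
  infinity with \<open>x\<close> fixed.\<close>

lemma weighted_avg_eq:
  assumes K: "finite K" "K \<noteq> {}" and x: "x \<le> N"
  shows "weighted_avg r \<rho> K x =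
    (\<Sum>e\<in>exponent_families K N. diff_coeff r K N e * (\<Prod>j\<in>K. dvd_mean \<rho> x (smooth_part N e j)))"
proof -
  let ?E = "exponent_families K N"
  let ?w = "\<lambda>n. \<Prod>j\<in>K. (real (n j) / real x) powr \<rho>"
  have "(real (LCM j\<in>K. n j) / real (\<Prod>j\<in>K. n j)) powr r =
      (\<Sum>e\<in>?E. diff_coeff r K N e * (\<Prod>j\<in>K. of_bool (smooth_part N e j dvd n j)))"
    if n: "n \<in> K \<rightarrow>\<^sub>E {1..x}" for n
  proof -
    have n': "n j \<in> {1..N}" if "j \<in> K" for j
      using n that x by (fastforce simp: PiE_iff)
    have "(real (LCM j\<in>K. n j) / real (\<Prod>j\<in>K. n j)) powr r =
        (\<Prod>p\<in>primes_le N. lcm_local r K p (\<lambda>j. multiplicity p (n j)))"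
      by (rule lcm_ratio_powr_eq [OF K n'])
    also have "\<dots> = (\<Sum>e\<in>?E. diff_coeff r K N e *
        of_bool (\<forall>j\<in>K. \<forall>p\<in>primes_le N. e p j \<le> multiplicity p (n j)))"
    proof (rule prod_lcm_local_expand [OF K(1)])
      fix p j assume "p \<in> primes_le N" "j \<in> K"
      then show "multiplicity p (n j) \<le> N"
        using multiplicity_le_self [of "n j" p] n' [of j] by (auto simp: primes_le_def)
    qed
    also have "\<dots> = (\<Sum>e\<in>?E. diff_coeff r K N e * of_bool (\<forall>j\<in>K. smooth_part N e j dvd n j))"
    proof (intro sum.cong refl arg_cong2 [of _ _ _ _ "(*)"] arg_cong [of _ _ of_bool] ball_cong)
      fix e j assume "j \<in> K"
      then show "(\<forall>p\<in>primes_le N. e p j \<le> multiplicity p (n j)) = (smooth_part N e j dvd n j)"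
        using n' [of j] by (subst smooth_part_dvd_iff) auto
    qed
    finally show ?thesis
      by (simp only: of_bool_Ball [OF K(1)])
  qed
  then have "weighted_avg r \<rho> K x = 1 / real x ^ card K * (\<Sum>n\<in>K \<rightarrow>\<^sub>E {1..x}.
      (\<Sum>e\<in>?E. diff_coeff r K N e * (\<Prod>j\<in>K. of_bool (smooth_part N e j dvd n j))) * ?w n)"
    unfolding weighted_avg_def by simp
  also have "\<dots> = (\<Sum>e\<in>?E. diff_coeff r K N e * (1 / real x ^ card K * (\<Sum>n\<in>K \<rightarrow>\<^sub>E {1..x}.
      \<Prod>j\<in>K. of_bool (smooth_part N e j dvd n j) * (real (n j) / real x) powr \<rho>)))"
    unfolding sum_distrib_left sum_distrib_right prod.distrib
    by (subst sum.swap) (simp add: mult_ac)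
  also have "\<dots> = (\<Sum>e\<in>?E. diff_coeff r K N e * (\<Prod>j\<in>K. dvd_mean \<rho> x (smooth_part N e j)))"
  proof (intro sum.cong refl arg_cong2 [of _ _ _ _ "(*)"])
    fix e
    have "(\<Prod>j\<in>K. dvd_mean \<rho> x (smooth_part N e j)) =
        (\<Prod>j\<in>K. \<Sum>n\<in>{1..x}. of_bool (smooth_part N e j dvd n) * (real n / real x) powr \<rho>) / real x ^ card K"
      by (simp add: dvd_mean_def prod_dividef)
    also have "\<dots> = 1 / real x ^ card K * (\<Sum>n\<in>K \<rightarrow>\<^sub>E {1..x}.
        \<Prod>j\<in>K. of_bool (smooth_part N e j dvd n j) * (real (n j) / real x) powr \<rho>)"
      using K by (subst prod_sum_PiE) auto
    finally show "1 / real x ^ card K * (\<Sum>n\<in>K \<rightarrow>\<^sub>E {1..x}.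
        \<Prod>j\<in>K. of_bool (smooth_part N e j dvd n j) * (real (n j) / real x) powr \<rho>) =
        (\<Prod>j\<in>K. dvd_mean \<rho> x (smooth_part N e j))"
      by simp
  qed
  finally show ?thesis .
qed

text \<open>The main term before the limit, later identified with the expectation of
  \<open>truncated_R k N \<omega> powr r\<close>.\<close>

definition truncated_const :: "real \<Rightarrow> 'i set \<Rightarrow> nat \<Rightarrow> real" where
  "truncated_const r K N =
    (\<Sum>e\<in>exponent_families K N. diff_coeff r K N e / (\<Prod>j\<in>K. real (smooth_part N e j)))"

lemma sum_diff_coeff_powr_eq:
  assumes K: "finite K" "i \<in> K"
  shows "(\<Sum>e\<in>exponent_families K N. \<bar>diff_coeff r K N e\<bar> / (\<Prod>j\<in>K. real (smooth_part N e j)) *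
      real (smooth_part N e i) powr s) = (\<Prod>p\<in>primes_le N. local_series r K N i s p)"
proof -
  have P: "real p > 0" if "p \<in> primes_le N" for p
    using that by (auto simp: primes_le_def prime_gt_0_nat)
  have "\<bar>diff_coeff r K N e\<bar> / (\<Prod>j\<in>K. real (smooth_part N e j)) * real (smooth_part N e i) powr s =
      (\<Prod>p\<in>primes_le N. \<bar>mixed_diff K N (lcm_local r K p) (e p)\<bar> *
        real p powr (s * real (e p i) - real (\<Sum>j\<in>K. e p j)))" for e
  proof -
    have "real (smooth_part N e i) powr s = (\<Prod>p\<in>primes_le N. (real p ^ e p i) powr s)"
      unfolding smooth_part_def by (simp add: prod_powr_distrib)
    moreover have "(\<Prod>j\<in>K. real (smooth_part N e j)) = (\<Prod>p\<in>primes_le N. real p ^ (\<Sum>j\<in>K. e p j))"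
      unfolding smooth_part_def of_nat_prod of_nat_power power_sum by (rule prod.swap)
    ultimately have "\<bar>diff_coeff r K N e\<bar> / (\<Prod>j\<in>K. real (smooth_part N e j)) * real (smooth_part N e i) powr s =
        (\<Prod>p\<in>primes_le N. \<bar>mixed_diff K N (lcm_local r K p) (e p)\<bar> / real p ^ (\<Sum>j\<in>K. e p j) *
          (real p ^ e p i) powr s)"
      by (simp add: diff_coeff_def abs_prod prod.distrib prod_dividef)
    also have "\<dots> = (\<Prod>p\<in>primes_le N. \<bar>mixed_diff K N (lcm_local r K p) (e p)\<bar> *
        real p powr (s * real (e p i) - real (\<Sum>j\<in>K. e p j)))"
    proof (rule prod.cong [OF refl])
      fix p assume "p \<in> primes_le N"
      then have "p > 0"
        using P by force
      then have "real p powr (s * real (e p i) - real (\<Sum>j\<in>K. e p j)) =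
          (real p ^ e p i) powr s / real p ^ (\<Sum>j\<in>K. e p j)"
        by (simp add: powr_diff powr_realpow [symmetric] powr_powr mult.commute del: of_nat_sum)
      then show "\<bar>mixed_diff K N (lcm_local r K p) (e p)\<bar> / real p ^ (\<Sum>j\<in>K. e p j) *
          (real p ^ e p i) powr s = \<bar>mixed_diff K N (lcm_local r K p) (e p)\<bar> *
          real p powr (s * real (e p i) - real (\<Sum>j\<in>K. e p j))"
        by simp
    qed
    finally show ?thesis .
  qed
  then show ?thesis
    unfolding local_series_def exponent_families_def
    using K by (subst prod_sum_PiE) (auto intro!: finite_PiE)
qed

text \<open>As \<open>d_i \<ge> 1\<close>, inserting the weight \<open>d_i^s\<close> can only
  increase the terms. This makes the Euler product bounds available for the main term, uniformly in
  \<open>N\<close>.\<close>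

lemma abs_truncated_const_le:
  assumes K: "finite K" "i \<in> K" and "s \<ge> 0"
  shows "\<bar>truncated_const r K N\<bar> \<le> (\<Prod>p\<in>primes_le N. local_series r K N i s p)"
proof -
  have "\<bar>truncated_const r K N\<bar> \<le>
      (\<Sum>e\<in>exponent_families K N. \<bar>diff_coeff r K N e / (\<Prod>j\<in>K. real (smooth_part N e j))\<bar>)"
    unfolding truncated_const_def by (rule sum_abs)
  also have "\<dots> \<le> (\<Sum>e\<in>exponent_families K N. \<bar>diff_coeff r K N e\<bar> / (\<Prod>j\<in>K. real (smooth_part N e j)) *
      real (smooth_part N e i) powr s)"
  proof (rule sum_mono)
    fix e
    have "1 \<le> real (smooth_part N e i) powr s"
      using smooth_part_pos [of N e i] assms by (intro ge_one_powr_ge_zero) (auto simp: Suc_le_eq)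
    moreover have "(\<Prod>j\<in>K. real (smooth_part N e j)) > 0"
      using smooth_part_pos [of N e] by (intro prod_pos) auto
    ultimately show "\<bar>diff_coeff r K N e / (\<Prod>j\<in>K. real (smooth_part N e j))\<bar> \<le>
        \<bar>diff_coeff r K N e\<bar> / (\<Prod>j\<in>K. real (smooth_part N e j)) * real (smooth_part N e i) powr s"
      using mult_left_mono [of 1 "real (smooth_part N e i) powr s"
          "\<bar>diff_coeff r K N e\<bar> / (\<Prod>j\<in>K. real (smooth_part N e j))"]
      by (simp add: abs_divide)
  qed
  finally show ?thesis
    by (simp only: sum_diff_coeff_powr_eq [OF K])
qed

text \<open>Division by \<open>C\<close> brings all factors into the unit ball, where a product
  changes by at most the sum of the changes of its factors.\<close>

lemma abs_prod_diff_le: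
  fixes z w :: "'i \<Rightarrow> real"
  assumes "finite K" "C \<ge> 1" "\<And>j. j \<in> K \<Longrightarrow> \<bar>z j\<bar> \<le> C" "\<And>j. j \<in> K \<Longrightarrow> \<bar>w j\<bar> \<le> C"
  shows "\<bar>(\<Prod>j\<in>K. z j) - (\<Prod>j\<in>K. w j)\<bar> \<le> C ^ card K * (\<Sum>j\<in>K. \<bar>z j - w j\<bar>)"
proof -
  have "norm ((\<Prod>j\<in>K. z j / C) - (\<Prod>j\<in>K. w j / C)) \<le> (\<Sum>j\<in>K. norm (z j / C - w j / C))"
    using assms by (intro norm_prod_diff) (auto simp: abs_divide)
  also have "\<dots> \<le> (\<Sum>j\<in>K. \<bar>z j - w j\<bar>)"
  proof (rule sum_mono)
    fix j
    have "\<bar>z j - w j\<bar> / C \<le> \<bar>z j - w j\<bar> / 1"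
      using assms(2) by (intro divide_left_mono) auto
    then show "norm (z j / C - w j / C) \<le> \<bar>z j - w j\<bar>"
      using assms(2) by (simp add: diff_divide_distrib [symmetric] abs_divide)
  qed
  finally show ?thesis
    using assms(2) by (simp add: prod_dividef diff_divide_distrib [symmetric] abs_divide divide_le_eq mult.commute)
qed

lemma weighted_avg_approx:
  assumes K: "finite K" "K \<noteq> {}" and \<rho>: "\<rho> > -1"
  shows "\<exists>C>0. \<forall>x N s. x \<ge> 1 \<longrightarrow> x \<le> N \<longrightarrow> 0 \<le> s \<longrightarrow> s \<le> 1 \<longrightarrow> s \<le> 1 + \<rho> \<longrightarrow>
    \<bar>weighted_avg r \<rho> K x - truncated_const r K N / (\<rho> + 1) ^ card K\<bar> \<le>
      C * real x powr (- s) * (\<Sum>i\<in>K. \<Prod>p\<in>primes_le N. local_series r K N i s p)"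
proof -
  obtain C where C: "C \<ge> 1" "1 / (\<rho> + 1) \<le> C"
    and mean: "\<And>x d s. x \<ge> 1 \<Longrightarrow> d \<ge> 1 \<Longrightarrow> 0 \<le> s \<Longrightarrow> s \<le> 1 \<Longrightarrow> s \<le> 1 + \<rho> \<Longrightarrow>
      \<bar>real d * dvd_mean \<rho> x d\<bar> \<le> C \<and>
      \<bar>real d * dvd_mean \<rho> x d - 1 / (\<rho> + 1)\<bar> \<le> C * (real d / real x) powr s"
    using dvd_mean_approx [OF \<rho>] by blast
  show ?thesis
  proof (intro exI conjI allI impI)
    fix x N :: nat and s :: real
    assume x: "x \<ge> 1" "x \<le> N" "0 \<le> s" "s \<le> 1" "s \<le> 1 + \<rho>"
    let ?d = "\<lambda>e j. real (smooth_part N e j)"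
    let ?E = "exponent_families K N"
    have d: "?d e j > 0" "smooth_part N e j \<ge> 1" for e :: "nat \<Rightarrow> 'a \<Rightarrow> nat" and j
      using smooth_part_pos [of N e j] by auto
    have dp: "(\<Prod>j\<in>K. ?d e j) > 0" for e
      using d by (intro prod_pos) auto
    \<comment> \<open>Each mean carries a factor \<open>1 / d_j\<close>; with these taken out,
      \<open>T\<close> compares products of bounded quantities with their main terms.\<close>
    define T where "T e = (\<Prod>j\<in>K. ?d e j * dvd_mean \<rho> x (smooth_part N e j)) - (\<Prod>j\<in>K. 1 / (\<rho> + 1))" for e
    have "weighted_avg r \<rho> K x - truncated_const r K N / (\<rho> + 1) ^ card K =
        (\<Sum>e\<in>?E. diff_coeff r K N e / (\<Prod>j\<in>K. ?d e j) * T e)"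
      unfolding weighted_avg_eq [OF K x(2)] truncated_const_def sum_divide_distrib sum_subtractf [symmetric]
    proof (rule sum.cong [OF refl])
      fix e
      show "diff_coeff r K N e * (\<Prod>j\<in>K. dvd_mean \<rho> x (smooth_part N e j)) -
          diff_coeff r K N e / (\<Prod>j\<in>K. ?d e j) / (\<rho> + 1) ^ card K =
          diff_coeff r K N e / (\<Prod>j\<in>K. ?d e j) * T e"
        using dp [of e] unfolding T_def prod.distrib right_diff_distrib by (simp add: power_one_over divide_simps)
    qed
    also have "\<bar>\<dots>\<bar> \<le> (\<Sum>e\<in>?E. \<bar>diff_coeff r K N e / (\<Prod>j\<in>K. ?d e j) * T e\<bar>)"
      by (rule sum_abs)
    also have "\<dots> \<le> (\<Sum>e\<in>?E. \<bar>diff_coeff r K N e\<bar> / (\<Prod>j\<in>K. ?d e j) *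
        (C ^ card K * (\<Sum>i\<in>K. C * (real x powr (- s) * ?d e i powr s))))"
    proof (rule sum_mono)
      fix e
      have "\<bar>T e\<bar> \<le>
          C ^ card K * (\<Sum>i\<in>K. \<bar>?d e i * dvd_mean \<rho> x (smooth_part N e i) - 1 / (\<rho> + 1)\<bar>)"
        unfolding T_def
      proof (rule abs_prod_diff_le [OF K(1) C(1)])
        show "\<bar>?d e j * dvd_mean \<rho> x (smooth_part N e j)\<bar> \<le> C" for j
          using mean [OF x(1) d(2) x(3-5)] by blast
        show "\<bar>1 / (\<rho> + 1)\<bar> \<le> C"
          using C \<rho> by simp
      qed
      also have "\<dots> \<le> C ^ card K * (\<Sum>i\<in>K. C * (real x powr (- s) * ?d e i powr s))"
      proof (intro mult_left_mono sum_mono)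
        fix i
        have "(?d e i / real x) powr s = real x powr (- s) * ?d e i powr s"
          using x d(1) [of e i] by (simp add: powr_divide powr_minus field_simps)
        then show "\<bar>?d e i * dvd_mean \<rho> x (smooth_part N e i) - 1 / (\<rho> + 1)\<bar> \<le>
            C * (real x powr (- s) * ?d e i powr s)"
          using mean [OF x(1) d(2) x(3-5), of e i] by simp
      qed (use C in auto)
      finally show "\<bar>diff_coeff r K N e / (\<Prod>j\<in>K. ?d e j) * T e\<bar> \<le>
          \<bar>diff_coeff r K N e\<bar> / (\<Prod>j\<in>K. ?d e j) *
          (C ^ card K * (\<Sum>i\<in>K. C * (real x powr (- s) * ?d e i powr s)))"
        unfolding abs_mult abs_divide abs_of_pos [OF dp]
        using dp [of e] by (intro mult_left_mono divide_nonneg_pos) auto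
    qed
    also have "\<dots> = C ^ card K * C * real x powr (- s) *
        (\<Sum>i\<in>K. \<Sum>e\<in>?E. \<bar>diff_coeff r K N e\<bar> / (\<Prod>j\<in>K. ?d e j) * ?d e i powr s)"
      unfolding sum_distrib_left by (subst sum.swap) (simp add: mult_ac)
    also have "\<dots> = C ^ card K * C * real x powr (- s) *
        (\<Sum>i\<in>K. \<Prod>p\<in>primes_le N. local_series r K N i s p)"
      using sum_diff_coeff_powr_eq [OF K(1)] by simp
    finally show "\<bar>weighted_avg r \<rho> K x - truncated_const r K N / (\<rho> + 1) ^ card K\<bar> \<le>
        C ^ card K * C * real x powr (- s) * (\<Sum>i\<in>K. \<Prod>p\<in>primes_le N. local_series r K N i s p)" .
  qed (use C in auto)
qed

subsection \<open>The random Euler product\<close>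

lemma measure_geometric_pmf_atLeast:
  assumes "p \<ge> 2"
  shows "measure (measure_pmf (geometric_pmf (1 - 1 / real p))) {m..} = (1 / real p) ^ m"
proof -
  have p: "0 < 1 - 1 / real p" "1 - 1 / real p \<le> 1" "1 / real p \<noteq> 1"
    using assms by (auto simp: field_simps)
  have "measure (measure_pmf (geometric_pmf (1 - 1 / real p))) {..<m} = (\<Sum>n<m. (1 / real p) ^ n * (1 - 1 / real p))"
    using p by (subst measure_measure_pmf_finite) auto
  also have "\<dots> = 1 - (1 / real p) ^ m"
    using one_diff_power_eq [of "1 / real p" m] by (simp add: sum_distrib_left mult.commute)
  moreover have "{m..} = - {..<m}"
    by auto
  ultimately show ?thesis
    using measure_pmf.prob_compl [of "{..<m}" "geometric_pmf (1 - 1 / real p)"]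
    by (simp add: Compl_eq_Diff_UNIV)
qed

definition geom_factors :: "nat \<times> nat \<Rightarrow> nat measure" where
  "geom_factors = (\<lambda>(j, p). measure_pmf (geometric_pmf (1 - 1 / real p)))"

lemma geom_space_eq: "geom_space k = PiM ({1..k} \<times> {p. prime p}) geom_factors"
  by (simp add: geom_space_def geom_factors_def)

interpretation geom: product_prob_space geom_factors "{1..k} \<times> {p. prime p}" for k
  by (rule product_prob_spaceI) (simp add: geom_factors_def measure_pmf.prob_space_axioms split: prod.split)

lemma prob_space_geom_space: "prob_space (geom_space k)"
  unfolding geom_space_eq by (rule geom.P.prob_space_axioms)

lemma measurable_geom_space_component [measurable]:
  assumes "j \<in> {1..k}" "prime p"
  shows "(\<lambda>\<omega>. \<omega> (j, p)) \<in> measurable (geom_space k) (count_space UNIV)"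
proof -
  have "(\<lambda>\<omega>. \<omega> (j, p)) \<in> measurable (geom_space k) (geom_factors (j, p))"
    unfolding geom_space_eq using assms by (intro measurable_component_singleton) auto
  then show ?thesis
    by (simp add: geom_factors_def measurable_pmf_measure2)
qed

lemma sets_geom_space_atLeast:
  assumes "finite J" "J \<subseteq> {1..k} \<times> {p. prime p}"
  shows "{\<omega>\<in>space (geom_space k). \<forall>i\<in>J. a i \<le> \<omega> i} \<in> sets (geom_space k)"
proof (rule sets.sets_Collect_finite_All [OF _ assms(1)])
  fix i assume "i \<in> J"
  then have [measurable]: "(\<lambda>\<omega>. \<omega> i) \<in> measurable (geom_space k) (count_space UNIV)"
    using assms measurable_geom_space_component [of "fst i" k "snd i"] by auto
  show "{\<omega>\<in>space (geom_space k). a i \<le> \<omega> i} \<in> sets (geom_space k)"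
    by measurable
qed

lemma measure_geom_space_atLeast:
  assumes "finite J" "J \<subseteq> {1..k} \<times> {p. prime p}"
  shows "measure (geom_space k) {\<omega>\<in>space (geom_space k). \<forall>i\<in>J. a i \<le> \<omega> i} =
    (\<Prod>i\<in>J. (1 / real (snd i)) ^ a i)"
proof -
  have factor: "measure (geom_factors i) {a i..} = (1 / real (snd i)) ^ a i" if "i \<in> J" for i
    using that assms(2) measure_geometric_pmf_atLeast [of "snd i" "a i"] prime_ge_2_nat
    by (auto simp: geom_factors_def split: prod.splits)
  have "emeasure (geom_space k) {\<omega>\<in>space (geom_space k). \<forall>i\<in>J. \<omega> i \<in> {a i..}} =
      (\<Prod>i\<in>J. emeasure (geom_factors i) {a i..})"
    unfolding geom_space_eq using assms
    by (intro geom.emeasure_PiM_Collect) (auto simp: geom_factors_def split: prod.splits)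
  also have "\<dots> = (\<Prod>i\<in>J. ennreal ((1 / real (snd i)) ^ a i))"
    by (intro prod.cong refl) (simp add: geom.M.emeasure_eq_measure factor)
  also have "\<dots> = ennreal (\<Prod>i\<in>J. (1 / real (snd i)) ^ a i)"
    by (intro prod_ennreal) auto
  finally show ?thesis
    by (simp add: measure_def prod_nonneg)
qed

text \<open>The exponents are cut off at \<open>N\<close> along with the primes, so that
  \<open>prod_lcm_local_expand\<close> applies and produces the coefficients of
  \<open>weighted_avg_eq\<close>.\<close>

definition truncated_R :: "nat \<Rightarrow> nat \<Rightarrow> (nat \<times> nat \<Rightarrow> nat) \<Rightarrow> real" where
  "truncated_R k N \<omega> = (\<Prod>p\<in>primes_le N. lcm_local 1 {1..k} p (\<lambda>j. min (\<omega> (j, p)) N))"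

lemma lcm_local_nonneg: "lcm_local r K p a \<ge> 0"
  by (simp add: lcm_local_def)

lemma lcm_local_powr: "lcm_local s K p a powr r = lcm_local (s * r) K p a"
  by (simp add: lcm_local_def powr_powr mult_ac)

lemma truncated_R_powr:
  "truncated_R k N \<omega> powr r = (\<Prod>p\<in>primes_le N. lcm_local r {1..k} p (\<lambda>j. min (\<omega> (j, p)) N))"
  unfolding truncated_R_def by (simp add: prod_powr_distrib lcm_local_powr lcm_local_nonneg)

lemma truncated_R_powr_expand:
  assumes "\<omega> \<in> space (geom_space k)"
  shows "truncated_R k N \<omega> powr r = (\<Sum>e\<in>exponent_families {1..k} N. diff_coeff r {1..k} N e *
    indicator {\<omega>\<in>space (geom_space k). \<forall>i\<in>{1..k} \<times> primes_le N. e (snd i) (fst i) \<le> \<omega> i} \<omega>)"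
proof -
  have "truncated_R k N \<omega> powr r = (\<Sum>e\<in>exponent_families {1..k} N. diff_coeff r {1..k} N e *
      of_bool (\<forall>j\<in>{1..k}. \<forall>p\<in>primes_le N. e p j \<le> min (\<omega> (j, p)) N))"
    unfolding truncated_R_powr by (intro prod_lcm_local_expand) auto
  also have "\<dots> = (\<Sum>e\<in>exponent_families {1..k} N. diff_coeff r {1..k} N e *
    indicator {\<omega>\<in>space (geom_space k). \<forall>i\<in>{1..k} \<times> primes_le N. e (snd i) (fst i) \<le> \<omega> i} \<omega>)"
  proof (intro sum.cong refl arg_cong2 [of _ _ _ _ "(*)"])
    fix e assume "e \<in> exponent_families {1..k} N"
    \<comment> \<open>The exponents in the family are at most \<open>N\<close>, so truncating the
      random exponents does not affect the comparison.\<close>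
    then have "e p j \<le> N" if "p \<in> primes_le N" "j \<in> {1..k}" for p j
      using that by (fastforce simp: exponent_families_def PiE_iff)
    then have "(\<forall>j\<in>{1..k}. \<forall>p\<in>primes_le N. e p j \<le> min (\<omega> (j, p)) N) \<longleftrightarrow>
        (\<forall>i\<in>{1..k} \<times> primes_le N. e (snd i) (fst i) \<le> \<omega> i)"
      by auto
    then show "of_bool (\<forall>j\<in>{1..k}. \<forall>p\<in>primes_le N. e p j \<le> min (\<omega> (j, p)) N) =
        (indicator {\<omega>\<in>space (geom_space k). \<forall>i\<in>{1..k} \<times> primes_le N. e (snd i) (fst i) \<le> \<omega> i} \<omega> :: real)"
      using assms by (simp add: indicator_def)
  qed
  finally show ?thesis .
qed

lemma expectation_truncated_R:
  shows "integrable (geom_space k) (\<lambda>\<omega>. truncated_R k N \<omega> powr r)" (is ?A)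
    and "(LINT \<omega>|geom_space k. truncated_R k N \<omega> powr r) = truncated_const r {1..k} N" (is ?B)
proof -
  interpret prob_space "geom_space k"
    by (rule prob_space_geom_space)
  define S where "S e = {\<omega>\<in>space (geom_space k). \<forall>i\<in>{1..k} \<times> primes_le N. e (snd i) (fst i) \<le> \<omega> i}"
    for e :: "nat \<Rightarrow> nat \<Rightarrow> nat"
  have J: "finite ({1..k} \<times> primes_le N)" "{1..k} \<times> primes_le N \<subseteq> {1..k} \<times> {p. prime p}"
    by (auto simp: primes_le_def [of N])
  have S [measurable]: "S e \<in> sets (geom_space k)" for e
    unfolding S_def by (rule sets_geom_space_atLeast [OF J])
  have prob_S: "prob (S e) = 1 / (\<Prod>j\<in>{1..k}. real (smooth_part N e j))" for e
  proof -
    have "prob (S e) = (\<Prod>i\<in>{1..k} \<times> primes_le N. (1 / real (snd i)) ^ e (snd i) (fst i))"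
      unfolding S_def by (rule measure_geom_space_atLeast [OF J])
    also have "\<dots> = (\<Prod>j\<in>{1..k}. \<Prod>p\<in>primes_le N. 1 / real p ^ e p j)"
      by (subst prod.cartesian_product) (auto simp: power_one_over intro!: prod.cong)
    also have "\<dots> = 1 / (\<Prod>j\<in>{1..k}. real (smooth_part N e j))"
      by (simp add: smooth_part_def prod_dividef)
    finally show ?thesis .
  qed
  have eq: "truncated_R k N \<omega> powr r =
      (\<Sum>e\<in>exponent_families {1..k} N. diff_coeff r {1..k} N e * indicator (S e) \<omega>)"
    if "\<omega> \<in> space (geom_space k)" for \<omega>
    unfolding S_def by (rule truncated_R_powr_expand [OF that])
  have int: "integrable (geom_space k) (\<lambda>\<omega>. diff_coeff r {1..k} N e * indicator (S e) \<omega>)" for e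
    by (intro integrable_mult_right integrable_real_indicator) (auto simp: less_top [symmetric])
  show ?A
    by (subst Bochner_Integration.integrable_cong [OF refl eq], assumption)
       (intro Bochner_Integration.integrable_sum int)
  have "(LINT \<omega>|geom_space k. truncated_R k N \<omega> powr r) =
      (LINT \<omega>|geom_space k. (\<Sum>e\<in>exponent_families {1..k} N. diff_coeff r {1..k} N e * indicator (S e) \<omega>))"
    by (intro Bochner_Integration.integral_cong refl eq)
  also have "\<dots> = (\<Sum>e\<in>exponent_families {1..k} N. diff_coeff r {1..k} N e * prob (S e))"
    using int by (subst Bochner_Integration.integral_sum) auto
  also have "\<dots> = truncated_const r {1..k} N"
    by (simp add: prob_S truncated_const_def)
  finally show ?B .
qed

text \<open>Borel-Cantelli: both exponents are positive at \<open>p\<close> with probability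
  \<open>p^(-2)\<close>, which is summable.\<close>

lemma AE_geom_space_finite_pair:
  assumes "i \<in> {1..k}" "j \<in> {1..k}" "i \<noteq> j"
  shows "AE \<omega> in geom_space k. finite {p. prime p \<and> 1 \<le> \<omega> (i, p) \<and> 1 \<le> \<omega> (j, p)}"
proof -
  interpret prob_space "geom_space k"
    by (rule prob_space_geom_space)
  define A where "A p = (if prime p then
      {\<omega>\<in>space (geom_space k). \<forall>q\<in>{(i, p), (j, p)}. 1 \<le> \<omega> q} else {})" for p
  have A: "A p \<in> sets (geom_space k)" for p
    using assms sets_geom_space_atLeast [of "{(i, p), (j, p)}" k "\<lambda>_. 1"] by (auto simp: A_def)
  have prob: "prob (A p) \<le> inverse (real p ^ 2)" for p
  proof (cases "prime p")
    case True
    then show ?thesis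
      using assms measure_geom_space_atLeast [of "{(i, p), (j, p)}" k "\<lambda>_. 1"]
      by (simp add: A_def power2_eq_square inverse_eq_divide)
  qed (simp add: A_def)
  have "summable (\<lambda>p. prob (A p))"
  proof (rule summable_comparison_test')
    show "summable (\<lambda>p. inverse (real p ^ 2))"
      by (rule inverse_power_summable) simp
  qed (use prob in auto)
  then have "AE \<omega> in geom_space k. eventually (\<lambda>p. \<omega> \<in> space (geom_space k) - A p) sequentially"
    by (intro borel_cantelli_AE1 A) (auto simp: less_top [symmetric])
  then show ?thesis
  proof (rule AE_mp, intro AE_I2 impI)
    fix \<omega> assume \<omega>: "\<omega> \<in> space (geom_space k)"
      and "eventually (\<lambda>p. \<omega> \<in> space (geom_space k) - A p) sequentially"
    then obtain N where N: "\<omega> \<notin> A p" if "p \<ge> N" for p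
      by (auto simp: eventually_sequentially)
    have "p < N" if "prime p" "1 \<le> \<omega> (i, p)" "1 \<le> \<omega> (j, p)" for p
      using N [of p] that \<omega> by (force simp: A_def)
    then have "{p. prime p \<and> 1 \<le> \<omega> (i, p) \<and> 1 \<le> \<omega> (j, p)} \<subseteq> {..<N}"
      by auto
    then show "finite {p. prime p \<and> 1 \<le> \<omega> (i, p) \<and> 1 \<le> \<omega> (j, p)}"
      by (rule finite_subset) simp
  qed
qed

definition nontrivial_primes :: "nat \<Rightarrow> (nat \<times> nat \<Rightarrow> nat) \<Rightarrow> nat set" where
  "nontrivial_primes k \<omega> = {p. prime p \<and> (MAX j\<in>{1..k}. \<omega> (j, p)) \<noteq> (\<Sum>j\<in>{1..k}. \<omega> (j, p))}"

lemma Max_neq_sum_imp: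
  assumes K: "finite K" "K \<noteq> {}" and neq: "(MAX j\<in>K. a j) \<noteq> (\<Sum>j\<in>K. a j :: nat)"
  shows "\<exists>i\<in>K. \<exists>j\<in>K. i \<noteq> j \<and> 1 \<le> a i \<and> 1 \<le> a j"
proof -
  have "Max (a ` K) \<in> a ` K"
    using assms by (intro Max_in) auto
  then obtain i where i: "i \<in> K" "Max (a ` K) = a i"
    by auto
  have "(\<Sum>j\<in>K. a j) = a i + (\<Sum>j\<in>K - {i}. a j)"
    using K i by (simp add: sum.remove)
  with neq i have "(\<Sum>j\<in>K - {i}. a j) \<noteq> 0"
    by simp
  then obtain j where j: "j \<in> K" "j \<noteq> i" "a j \<noteq> 0"
    using K by (auto simp: sum_eq_0_iff)
  moreover have "a j \<le> Max (a ` K)"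
    using j K by simp
  ultimately show ?thesis
    using i by (intro bexI [of _ i] bexI [of _ j]) auto
qed

lemma AE_finite_nontrivial_primes:
  assumes "k \<ge> 1"
  shows "AE \<omega> in geom_space k. finite (nontrivial_primes k \<omega>)"
proof -
  let ?Q = "{(i, j). i \<in> {1..k} \<and> j \<in> {1..k} \<and> i \<noteq> j}"
  have fin: "finite ?Q"
    by (rule finite_subset [of _ "{1..k} \<times> {1..k}"]) auto
  have "AE \<omega> in geom_space k. \<forall>q\<in>?Q. finite {p. prime p \<and> 1 \<le> \<omega> (fst q, p) \<and> 1 \<le> \<omega> (snd q, p)}"
    using AE_geom_space_finite_pair by (intro AE_finite_allI fin) auto
  then show ?thesis
  proof (rule AE_mp, intro AE_I2 impI)
    fix \<omega> :: "nat \<times> nat \<Rightarrow> nat"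
    assume "\<forall>q\<in>?Q. finite {p. prime p \<and> 1 \<le> \<omega> (fst q, p) \<and> 1 \<le> \<omega> (snd q, p)}"
    then have "finite (\<Union>q\<in>?Q. {p. prime p \<and> 1 \<le> \<omega> (fst q, p) \<and> 1 \<le> \<omega> (snd q, p)})"
      using fin by blast
    moreover have "nontrivial_primes k \<omega> \<subseteq> (\<Union>q\<in>?Q. {p. prime p \<and> 1 \<le> \<omega> (fst q, p) \<and> 1 \<le> \<omega> (snd q, p)})"
    proof
      fix p assume "p \<in> nontrivial_primes k \<omega>"
      then have "prime p" "(MAX j\<in>{1..k}. \<omega> (j, p)) \<noteq> (\<Sum>j\<in>{1..k}. \<omega> (j, p))"
        by (auto simp: nontrivial_primes_def)
      then obtain i j where "i \<in> {1..k}" "j \<in> {1..k}" "i \<noteq> j" "1 \<le> \<omega> (i, p)" "1 \<le> \<omega> (j, p)"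
        using Max_neq_sum_imp [of "{1..k}" "\<lambda>j. \<omega> (j, p)"] assms by auto
      with \<open>prime p\<close> show "p \<in> (\<Union>q\<in>?Q. {p. prime p \<and> 1 \<le> \<omega> (fst q, p) \<and> 1 \<le> \<omega> (snd q, p)})"
        by (intro UN_I [of "(i, j)"]) auto
    qed
    ultimately show "finite (nontrivial_primes k \<omega>)"
      by (rule rev_finite_subset)
  qed
qed

definition R_factor :: "nat \<Rightarrow> (nat \<times> nat \<Rightarrow> nat) \<Rightarrow> nat \<Rightarrow> real" where
  "R_factor k \<omega> p = (if prime p then lcm_local 1 {1..k} p (\<lambda>j. \<omega> (j, p)) else 1)"

lemma R_prod_eq: "R_prod k \<omega> = prodinf (R_factor k \<omega>)"
proof -
  have "(if prime p then real p powi (int (MAX j\<in>{1..k}. \<omega> (j, p)) - int (\<Sum>j\<in>{1..k}. \<omega> (j, p))) else 1) =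
      R_factor k \<omega> p" for p
    using powr_real_of_int' [of "real p" "int (MAX j\<in>{1..k}. \<omega> (j, p)) - int (\<Sum>j\<in>{1..k}. \<omega> (j, p))"]
    by (auto simp: R_factor_def lcm_local_def prime_gt_0_nat simp del: of_nat_sum)
  then show ?thesis
    by (simp add: R_prod_def)
qed

lemma prod_R_factor: "(\<Prod>p\<le>N. R_factor k \<omega> p) = (\<Prod>p\<in>primes_le N. lcm_local 1 {1..k} p (\<lambda>j. \<omega> (j, p)))"
  by (rule prod.mono_neutral_cong_right) (auto simp: primes_le_def R_factor_def)

text \<open>Let \<open>M\<close> bound the nontrivial primes and the exponents at them. From
  \<open>M\<close> on, the partial products and the truncated products all equal one finite product
  \<open>c\<close>.\<close>

lemma R_prod_finite:
  assumes k: "k \<ge> 1" and fin: "finite (nontrivial_primes k \<omega>)"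
  shows "\<exists>n>0. R_prod k \<omega> = 1 / real n"
    and "eventually (\<lambda>N. truncated_R k N \<omega> = R_prod k \<omega>) sequentially"
proof -
  let ?S = "nontrivial_primes k \<omega>"
  let ?a = "\<lambda>p j. \<omega> (j, p)"
  have K: "finite {1..k}" "{1..k} \<noteq> {}"
    using k by auto
  have pos: "real p > 0" if "p \<in> ?S" for p
    using that by (auto simp: nontrivial_primes_def prime_gt_0_nat)
  define c where "c = (\<Prod>p\<in>?S. lcm_local 1 {1..k} p (?a p))"
  define M where "M = Max (insert 0 (?S \<union> (\<lambda>(j, p). \<omega> (j, p)) ` ({1..k} \<times> ?S)))"
  have M_S: "p \<le> M" if "p \<in> ?S" for p
    unfolding M_def using that fin by (intro Max_ge) auto
  have M_\<omega>: "\<omega> (j, p) \<le> M" if "p \<in> ?S" "j \<in> {1..k}" for p j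
    unfolding M_def using that fin by (intro Max_ge) auto
  \<comment> \<open>The excess of \<open>b\<close> is at most that of the full exponents, which is
    0. Allowing \<open>b\<close> below \<open>\<omega>\<close> covers truncation at the trivial
    primes, where a single exponent may well exceed \<open>N\<close>.\<close>
  have trivial: "lcm_local 1 {1..k} p b = 1"
    if p: "prime p" "p \<notin> ?S" and b: "\<And>j. j \<in> {1..k} \<Longrightarrow> b j \<le> ?a p j" for p b
  proof -
    have "(MAX j\<in>{1..k}. ?a p j) = (\<Sum>j\<in>{1..k}. ?a p j)"
      using p by (simp add: nontrivial_primes_def)
    moreover have "(\<Sum>j\<in>{1..k}. b j) + (MAX j\<in>{1..k}. ?a p j) \<le> (\<Sum>j\<in>{1..k}. ?a p j) + (MAX j\<in>{1..k}. b j)"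
      using b by (rule excess_mono [OF K])
    ultimately have "(\<Sum>j\<in>{1..k}. b j) \<le> (MAX j\<in>{1..k}. b j)"
      by simp
    with Max_le_sum [OF K, of b] have "(MAX j\<in>{1..k}. b j) = (\<Sum>j\<in>{1..k}. b j)"
      by simp
    then show ?thesis
      using p by (simp add: lcm_local_def prime_gt_0_nat del: of_nat_sum)
  qed
  have sub: "?S \<subseteq> primes_le N" if "N \<ge> M" for N
  proof
    fix p assume "p \<in> ?S"
    then show "p \<in> primes_le N"
      using M_S [of p] that by (simp add: primes_le_def nontrivial_primes_def)
  qed
  have partial: "(\<Prod>p\<le>N. R_factor k \<omega> p) = c" if "N \<ge> M" for N
    unfolding prod_R_factor c_def using sub [OF that]
    by (intro prod.mono_neutral_right) (auto intro!: trivial simp: primes_le_def simp del: One_nat_def)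
  \<comment> \<open>With nonzero factors, convergence in the sense of \<open>has_prod\<close>
    demands a nonzero limit.\<close>
  have "c \<noteq> 0"
    using pos fin by (auto simp: c_def lcm_local_def)
  moreover have "(\<lambda>N. \<Prod>p\<le>N. R_factor k \<omega> p) \<longlonglongrightarrow> c"
    using partial by (intro tendsto_eventually) (auto simp: eventually_sequentially)
  ultimately have "R_factor k \<omega> has_prod c"
    by (simp add: has_prod_def raw_has_prod_def)
  then have R: "R_prod k \<omega> = c"
    unfolding R_prod_eq by (rule has_prod_unique [symmetric])
  have "truncated_R k N \<omega> = c" if "N \<ge> M" for N
  proof -
    have "truncated_R k N \<omega> = (\<Prod>p\<in>?S. lcm_local 1 {1..k} p (\<lambda>j. min (\<omega> (j, p)) N))"
      unfolding truncated_R_def using sub [OF that]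
      by (intro prod.mono_neutral_right) (auto intro!: trivial simp: primes_le_def simp del: One_nat_def)
    also have "\<dots> = c"
      unfolding c_def using M_\<omega> that
      by (intro prod.cong refl lcm_local_cong) (auto intro: min_absorb1 order_trans)
    finally show ?thesis .
  qed
  then show "eventually (\<lambda>N. truncated_R k N \<omega> = R_prod k \<omega>) sequentially"
    unfolding R by (auto simp: eventually_sequentially)
  define n where "n = (\<Prod>p\<in>?S. p ^ ((\<Sum>j\<in>{1..k}. ?a p j) - (MAX j\<in>{1..k}. ?a p j)))"
  have "n > 0"
    using pos by (auto simp: n_def intro!: prod_pos)
  moreover have "c = 1 / real n"
  proof -
    have "c = (\<Prod>p\<in>?S. 1 / real p ^ ((\<Sum>j\<in>{1..k}. ?a p j) - (MAX j\<in>{1..k}. ?a p j)))"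
      unfolding c_def
    proof (rule prod.cong [OF refl])
      fix p assume p: "p \<in> ?S"
      have "real (MAX j\<in>{1..k}. ?a p j) - real (\<Sum>j\<in>{1..k}. ?a p j) =
          - real ((\<Sum>j\<in>{1..k}. ?a p j) - (MAX j\<in>{1..k}. ?a p j))"
        using Max_le_sum [OF K, of "?a p"] by (simp add: of_nat_diff del: of_nat_sum)
      then show "lcm_local 1 {1..k} p (?a p) = 1 / real p ^ ((\<Sum>j\<in>{1..k}. ?a p j) - (MAX j\<in>{1..k}. ?a p j))"
        unfolding lcm_local_def using pos [OF p]
        by (simp only: mult_1 powr_minus powr_realpow) (simp add: field_simps)
    qed
    then show ?thesis
      by (simp add: n_def prod_dividef)
  qed
  ultimately show "\<exists>n>0. R_prod k \<omega> = 1 / real n"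
    using R by auto
qed

section \<open>Measurability of the random product\<close>

lemma measurable_lcm_local [measurable]:
  assumes "prime p"
  shows "(\<lambda>\<omega>. lcm_local r {1..k} p (\<lambda>j. \<omega> (j, p))) \<in> borel_measurable (geom_space k)"
proof -
  have [measurable]: "(\<lambda>\<omega>. \<lambda>j\<in>{1..k}. \<omega> (j, p)) \<in> measurable (geom_space k) (PiM {1..k} (\<lambda>_. count_space UNIV))"
    using assms by (intro measurable_restrict measurable_geom_space_component)
  have "lcm_local r {1..k} p \<in> borel_measurable (PiM {1..k} (\<lambda>_. count_space (UNIV :: nat set)))"
    by (subst count_space_PiM_finite) auto
  then have "(\<lambda>\<omega>. lcm_local r {1..k} p (\<lambda>j\<in>{1..k}. \<omega> (j, p))) \<in> borel_measurable (geom_space k)"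
    by measurable
  moreover have "lcm_local r {1..k} p (\<lambda>j\<in>{1..k}. \<omega> (j, p)) = lcm_local r {1..k} p (\<lambda>j. \<omega> (j, p))" for \<omega>
    by (rule lcm_local_cong) simp
  ultimately show ?thesis
    by simp
qed

lemma R_factor_bounds:
  assumes "k \<ge> 1"
  shows "R_factor k \<omega> p > 0" "R_factor k \<omega> p \<le> 1"
  using lcm_local_le_1 [of "{1..k}" 1 p "\<lambda>j. \<omega> (j, p)"] assms prime_gt_0_nat [of p]
  by (auto simp: R_factor_def Suc_le_eq) (auto simp: lcm_local_def)

text \<open>The partial products decrease, so they have a limit \<open>L\<close> at every point.
  Where \<open>L\<close> vanishes, no value satisfies \<open>has_prod\<close> and
  \<open>prodinf\<close> is one fixed unspecified number. This describes \<open>R_prod\<close>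
  everywhere, not only up to a null set.\<close>

lemma measurable_R_prod [measurable]:
  assumes k: "k \<ge> 1"
  shows "R_prod k \<in> borel_measurable (geom_space k)"
proof -
  define P where "P = (\<lambda>n \<omega>. \<Prod>p\<le>n. R_factor k \<omega> p)"
  have "\<exists>L. (\<lambda>n. P n \<omega>) \<longlonglongrightarrow> L" for \<omega>
  proof -
    have "decseq (\<lambda>n. P n \<omega>)"
    proof (rule decseq_SucI)
      fix n
      have "P n \<omega> \<ge> 0"
        unfolding P_def using R_factor_bounds(1) [OF k] by (intro prod_nonneg) (simp add: less_imp_le)
      then show "P (Suc n) \<omega> \<le> P n \<omega>"
        using R_factor_bounds [OF k, of \<omega> "Suc n"] by (simp add: P_def mult_left_le)
    qed
    moreover have "0 \<le> P n \<omega>" for n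
      unfolding P_def using R_factor_bounds(1) [OF k] by (intro prod_nonneg) (simp add: less_imp_le)
    ultimately show ?thesis
      using decseq_convergent [of "\<lambda>n. P n \<omega>" 0] by metis
  qed
  then obtain L where L: "(\<lambda>n. P n \<omega>) \<longlonglongrightarrow> L \<omega>" for \<omega>
    by metis
  have factor: "(\<lambda>\<omega>. R_factor k \<omega> p) \<in> borel_measurable (geom_space k)" for p
    using measurable_lcm_local [of p 1 k] by (cases "prime p") (simp_all add: R_factor_def)
  then have "P n \<in> borel_measurable (geom_space k)" for n
    unfolding P_def by (intro borel_measurable_prod)
  then have [measurable]: "L \<in> borel_measurable (geom_space k)"
    by (rule borel_measurable_LIMSEQ_real [OF L])
  have "R_prod k \<omega> = (if L \<omega> = 0 then THE x. False else L \<omega>)" for \<omega>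
  proof (cases "L \<omega> = 0")
    case True
    have "\<not> R_factor k \<omega> has_prod x" for x
    proof
      assume "R_factor k \<omega> has_prod x"
      moreover have "R_factor k \<omega> i \<noteq> 0" for i
        using R_factor_bounds(1) [OF k, of \<omega> i] by simp
      ultimately have "P n \<omega> \<noteq> 0" "(\<lambda>n. P n \<omega>) \<longlonglongrightarrow> x" "x \<noteq> 0" for n
        by (auto simp: has_prod_def raw_has_prod_def P_def)
      then show False
        using LIMSEQ_unique [OF L] True by metis
    qed
    then show ?thesis
      using True by (simp add: R_prod_eq prodinf_def)
  next
    case False
    then have "R_factor k \<omega> has_prod L \<omega>"
      using L [of \<omega>] by (simp add: has_prod_def raw_has_prod_def P_def)
    then show ?thesis
      using False by (simp add: R_prod_eq has_prod_unique [symmetric])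
  qed
  then have "R_prod k = (\<lambda>\<omega>. if L \<omega> = 0 then THE x. False else L \<omega>)"
    by auto
  then show ?thesis
    by simp
qed

lemma truncated_R_nonneg: "truncated_R k N \<omega> \<ge> 0"
  by (simp add: truncated_R_def prod_nonneg lcm_local_nonneg)

lemma truncated_R_le_1: "k \<ge> 1 \<Longrightarrow> truncated_R k N \<omega> \<le> 1"
  unfolding truncated_R_def
  by (intro prod_le_1 conjI lcm_local_nonneg lcm_local_le_1)
     (auto simp: primes_le_def prime_gt_0_nat Suc_le_eq)

text \<open>Raising the cutoff adds factors that are at least 1 and enlarges the exponents in the
  others, which increases \<open>lcm_local\<close> for \<open>r \<le> 0\<close>.\<close>

lemma mono_truncated_R_powr:
  assumes k: "k \<ge> 1" and r: "r \<le> 0"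
  shows "mono (\<lambda>N. truncated_R k N \<omega> powr r)"
proof (rule monoI)
  fix N N' :: nat assume le: "N \<le> N'"
  have K: "finite {1..k}" "{1..k} \<noteq> {}"
    using k by auto
  have P: "p \<ge> 1" if "p \<in> primes_le M" for p M
    using that by (auto simp: primes_le_def prime_gt_0_nat Suc_le_eq)
  have ge_1: "1 \<le> lcm_local r {1..k} p a" if "p \<ge> 1" for p and a :: "nat \<Rightarrow> nat"
    using lcm_local_mono [OF K r that, of "\<lambda>_. 0" a] K that by (simp add: lcm_local_def)
  have "truncated_R k N \<omega> powr r \<le> (\<Prod>p\<in>primes_le N. lcm_local r {1..k} p (\<lambda>j. min (\<omega> (j, p)) N'))"
    unfolding truncated_R_powr using le P
    by (intro prod_mono conjI lcm_local_nonneg lcm_local_mono K r) auto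
  also have "\<dots> \<le> (\<Prod>p\<in>primes_le N'. lcm_local r {1..k} p (\<lambda>j. min (\<omega> (j, p)) N'))"
    using le P [of _ N'] ge_1 by (intro prod_mono2) (auto simp: primes_le_def lcm_local_nonneg)
  finally show "truncated_R k N \<omega> powr r \<le> truncated_R k N' \<omega> powr r"
    unfolding truncated_R_powr .
qed

text \<open>Almost surely \<open>truncated_R\<close> is eventually equal to \<open>R_prod\<close>.
  For \<open>r \<ge> 0\<close> the powers are at most 1 and dominated convergence applies. For
  \<open>r < 0\<close> they are unbounded but increase with \<open>N\<close>, and the Euler product
  bound keeps their integrals bounded.\<close>

lemma
  assumes k: "k \<ge> 1" and r: "r > -1"
  shows integrable_R_prod_powr: "integrable (geom_space k) (\<lambda>\<omega>. R_prod k \<omega> powr r)"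
    and truncated_const_tendsto:
      "(\<lambda>N. truncated_const r {1..k} N) \<longlonglongrightarrow> (LINT \<omega>|geom_space k. R_prod k \<omega> powr r)"
proof -
  interpret prob_space "geom_space k"
    by (rule prob_space_geom_space)
  have lim: "AE \<omega> in geom_space k. (\<lambda>N. truncated_R k N \<omega> powr r) \<longlonglongrightarrow> R_prod k \<omega> powr r"
    using AE_finite_nontrivial_primes [OF k]
  proof eventually_elim
    case (elim \<omega>)
    have "eventually (\<lambda>N. truncated_R k N \<omega> powr r = R_prod k \<omega> powr r) sequentially"
      using R_prod_finite(2) [OF k elim] by eventually_elim simp
    then show ?case
      by (rule tendsto_eventually)
  qed
  have meas: "(\<lambda>\<omega>. R_prod k \<omega> powr r) \<in> borel_measurable (geom_space k)"
    using measurable_R_prod [OF k] by measurable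
  have int: "integrable (geom_space k) (\<lambda>\<omega>. truncated_R k N \<omega> powr r)" for N
    by (rule expectation_truncated_R)
  have "integrable (geom_space k) (\<lambda>\<omega>. R_prod k \<omega> powr r) \<and>
      (\<lambda>N. LINT \<omega>|geom_space k. truncated_R k N \<omega> powr r) \<longlonglongrightarrow> (LINT \<omega>|geom_space k. R_prod k \<omega> powr r)"
  proof (cases "r \<ge> 0")
    case True
    have bound: "AE \<omega> in geom_space k. norm (truncated_R k N \<omega> powr r) \<le> 1" for N
      using True truncated_R_nonneg truncated_R_le_1 [OF k] by (auto intro!: powr_le1)
    show ?thesis
      using integrable_dominated_convergence [OF meas borel_measurable_integrable [OF int] _ lim bound]
        integral_dominated_convergence [OF meas borel_measurable_integrable [OF int] _ lim bound]
      by auto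
  next
    case False
    obtain C where C: "(\<Prod>p\<in>primes_le N. local_series r {1..k} N 1 ((1 + r) / 2) p) \<le> C" for N
      using prod_local_series_le_nonpos [of "{1..k}" 1 r] k r False by auto
    \<comment> \<open>Monotonicity is read off from the integrals, since
      \<open>truncated_const\<close> itself is a signed sum.\<close>
    have mono: "mono (\<lambda>N. truncated_const r {1..k} N)"
      unfolding expectation_truncated_R(2) [symmetric]
    proof (rule monoI)
      fix N N' :: nat assume "N \<le> N'"
      then show "(LINT \<omega>|geom_space k. truncated_R k N \<omega> powr r) \<le> (LINT \<omega>|geom_space k. truncated_R k N' \<omega> powr r)"
        using mono_truncated_R_powr [OF k, of r] False by (intro integral_mono int) (auto simp: mono_def)
    qed
    have bdd: "truncated_const r {1..k} N \<le> C" for N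
      using abs_truncated_const_le [of "{1..k}" 1 "(1 + r) / 2" r N] C [of N] k r by auto
    obtain l where l: "(\<lambda>N. truncated_const r {1..k} N) \<longlonglongrightarrow> l"
      using incseq_convergent [OF mono] bdd by metis
    then have l': "(\<lambda>N. LINT \<omega>|geom_space k. truncated_R k N \<omega> powr r) \<longlonglongrightarrow> l"
      by (simp add: expectation_truncated_R)
    have pos: "AE \<omega> in geom_space k. 0 \<le> truncated_R k N \<omega> powr r" for N
      by simp
    have mono': "AE \<omega> in geom_space k. mono (\<lambda>N. truncated_R k N \<omega> powr r)"
      using mono_truncated_R_powr [OF k, of r] False by simp
    show ?thesis
      using integral_monotone_convergence_nonneg [OF int mono' pos lim l' meas] l' by auto
  qed
  then show "integrable (geom_space k) (\<lambda>\<omega>. R_prod k \<omega> powr r)"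
    and "(\<lambda>N. truncated_const r {1..k} N) \<longlonglongrightarrow> (LINT \<omega>|geom_space k. R_prod k \<omega> powr r)"
    by (simp_all add: expectation_truncated_R)
qed

text \<open>Almost surely \<open>R_prod\<close> is \<open>1 / n\<close> for exactly one
  \<open>n\<close>, so its power is the sum of \<open>n powr (- r)\<close> times the indicators of
  these events. In the extended nonnegative reals sum and integral commute freely, and convergence
  then follows from integrability.\<close>

lemma
  assumes k: "k \<ge> 1" and r: "r > -1"
  shows summable_C_term: "summable (\<lambda>n. C_term r k (Suc n))"
    and C_const_eq: "C_const r k = (LINT \<omega>|geom_space k. R_prod k \<omega> powr r)"
proof -
  interpret prob_space "geom_space k"
    by (rule prob_space_geom_space)
  define A where "A n = {\<omega>\<in>space (geom_space k). R_prod k \<omega> = 1 / real n}" for n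
  have A [measurable]: "A n \<in> sets (geom_space k)" for n
    unfolding A_def using measurable_R_prod [OF k] by measurable
  have eq: "AE \<omega> in geom_space k. ennreal (R_prod k \<omega> powr r) =
      (\<Sum>n. ennreal (real (Suc n) powr (- r)) * indicator (A (Suc n)) \<omega>)"
  proof (rule AE_mp [OF AE_finite_nontrivial_primes [OF k]], intro AE_I2 impI)
    fix \<omega> assume \<omega>: "\<omega> \<in> space (geom_space k)" and "finite (nontrivial_primes k \<omega>)"
    then obtain m where m: "R_prod k \<omega> = 1 / real (Suc m)"
      using R_prod_finite(1) [OF k] by (metis gr0_implies_Suc)
    have "\<omega> \<in> A (Suc n) \<longleftrightarrow> n = m" for n
      using \<omega> m by (auto simp: A_def)
    then have "(\<Sum>n. ennreal (real (Suc n) powr (- r)) * indicator (A (Suc n)) \<omega>) =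
        (\<Sum>n. if n = m then ennreal (real (Suc n) powr (- r)) else 0)"
      by (intro suminf_cong) (auto simp: indicator_def)
    also have "\<dots> = ennreal (real (Suc m) powr (- r))"
      using suminf_finite [of "{m}" "\<lambda>n. if n = m then ennreal (real (Suc n) powr (- r)) else 0"] by simp
    also have "real (Suc m) powr (- r) = R_prod k \<omega> powr r"
      unfolding m by (simp add: powr_minus powr_divide inverse_eq_divide)
    finally show "ennreal (R_prod k \<omega> powr r) =
        (\<Sum>n. ennreal (real (Suc n) powr (- r)) * indicator (A (Suc n)) \<omega>)"
      by simp
  qed
  have nonneg: "C_term r k n \<ge> 0" for n
    by (simp add: C_term_def p_coeff_def)
  have "ennreal (LINT \<omega>|geom_space k. R_prod k \<omega> powr r) =
      (\<integral>\<^sup>+\<omega>. ennreal (R_prod k \<omega> powr r) \<partial>geom_space k)"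
    using integrable_R_prod_powr [OF k r] by (intro nn_integral_eq_integral [symmetric]) auto
  also have "\<dots> = (\<integral>\<^sup>+\<omega>. (\<Sum>n. ennreal (real (Suc n) powr (- r)) * indicator (A (Suc n)) \<omega>) \<partial>geom_space k)"
    by (rule nn_integral_cong_AE [OF eq])
  also have "\<dots> = (\<Sum>n. \<integral>\<^sup>+\<omega>. ennreal (real (Suc n) powr (- r)) * indicator (A (Suc n)) \<omega> \<partial>geom_space k)"
    by (intro nn_integral_suminf) measurable
  also have "\<dots> = (\<Sum>n. ennreal (C_term r k (Suc n)))"
  proof (rule suminf_cong)
    fix n
    have "C_term r k (Suc n) = real (Suc n) powr (- r) * prob (A (Suc n))"
      by (simp only: C_term_def p_coeff_def A_def)
    then show "(\<integral>\<^sup>+\<omega>. ennreal (real (Suc n) powr (- r)) * indicator (A (Suc n)) \<omega> \<partial>geom_space k) =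
        ennreal (C_term r k (Suc n))"
      by (simp add: nn_integral_cmult emeasure_eq_measure ennreal_mult')
  qed
  finally have sum: "(\<Sum>n. ennreal (C_term r k (Suc n))) = ennreal (LINT \<omega>|geom_space k. R_prod k \<omega> powr r)" ..
  show summable: "summable (\<lambda>n. C_term r k (Suc n))"
    using nonneg sum by (intro summable_suminf_not_top) auto
  have "ennreal (C_const r k) = ennreal (LINT \<omega>|geom_space k. R_prod k \<omega> powr r)"
    unfolding C_const_def sum [symmetric] by (rule suminf_ennreal2 [symmetric, OF nonneg summable])
  moreover have "C_const r k \<ge> 0"
    unfolding C_const_def by (intro suminf_nonneg summable nonneg)
  moreover have "(LINT \<omega>|geom_space k. R_prod k \<omega> powr r) \<ge> 0"
    by (intro integral_nonneg_AE) auto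
  ultimately show "C_const r k = (LINT \<omega>|geom_space k. R_prod k \<omega> powr r)"
    by (simp only: ennreal_inj)
qed

subsection \<open>Error terms\<close>

lemma lcm_avg_eq:
  assumes "k \<ge> 1" "x \<ge> 1"
  shows "lcm_avg r k x = weighted_avg r r {1..k} x"
proof -
  have "(real (LCM j\<in>{1..k}. n j) / real x ^ k) powr r =
      (real (LCM j\<in>{1..k}. n j) / real (\<Prod>j\<in>{1..k}. n j)) powr r * (\<Prod>j\<in>{1..k}. (real (n j) / real x) powr r)"
    if n: "n \<in> {1..k} \<rightarrow>\<^sub>E {1..x}" for n
  proof -
    have pos: "(\<Prod>j\<in>{1..k}. real (n j)) > 0"
    proof (rule prod_pos)
      fix j assume "j \<in> {1..k}"
      then have "n j \<in> {1..x}"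
        using n by (rule PiE_mem [rotated])
      then show "real (n j) > 0"
        by simp
    qed
    have cancel: "a / b * (b / c) = a / c" if "b \<noteq> 0" for a b c :: real
      using that by simp
    have "(\<Prod>j\<in>{1..k}. (real (n j) / real x) powr r) = (\<Prod>j\<in>{1..k}. real (n j) / real x) powr r"
      by (simp add: prod_powr_distrib)
    also have "(\<Prod>j\<in>{1..k}. real (n j) / real x) = (\<Prod>j\<in>{1..k}. real (n j)) / real x ^ k"
      by (simp add: prod_dividef)
    finally have "(real (LCM j\<in>{1..k}. n j) / real (\<Prod>j\<in>{1..k}. n j)) powr r *
        (\<Prod>j\<in>{1..k}. (real (n j) / real x) powr r) =
        (real (LCM j\<in>{1..k}. n j) / (\<Prod>j\<in>{1..k}. real (n j)) *
          ((\<Prod>j\<in>{1..k}. real (n j)) / real x ^ k)) powr r"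
      using pos by (subst powr_mult) auto
    also have "real (LCM j\<in>{1..k}. n j) / (\<Prod>j\<in>{1..k}. real (n j)) *
        ((\<Prod>j\<in>{1..k}. real (n j)) / real x ^ k) = real (LCM j\<in>{1..k}. n j) / real x ^ k"
      by (rule cancel) (use pos in linarith)
    finally show ?thesis ..
  qed
  then show ?thesis
    by (simp add: lcm_avg_def weighted_avg_def)
qed

lemma lcm_ratio_avg_eq:
  assumes "x \<ge> 1"
  shows "lcm_ratio_avg r k x = weighted_avg r 0 {1..k} x"
proof -
  have "(\<Prod>j\<in>{1..k}. (real (n j) / real x) powr 0) = 1" if n: "n \<in> {1..k} \<rightarrow>\<^sub>E {1..x}" for n
  proof (rule prod.neutral, rule ballI)
    fix j assume "j \<in> {1..k}"
    then have "n j \<in> {1..x}"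
      using n by (rule PiE_mem [rotated])
    then show "(real (n j) / real x) powr 0 = 1"
      by simp
  qed
  then show ?thesis
    by (simp add: lcm_ratio_avg_def weighted_avg_def)
qed

text \<open>Up to a null set the space is partitioned by the events \<open>B n\<close> that the
  variables take the values \<open>n\<close>, each of probability \<open>x^(-k)\<close>. The
  condition on \<open>h\<close> reconciles the full sequence of the \<open>X j\<close> with the
  restricted functions that index the sum.\<close>

lemma iid_uniform_expectation:
  fixes h :: "(nat \<Rightarrow> nat) \<Rightarrow> real"
  assumes iid: "iid_uniform M k x X" and k: "k \<ge> 1" and x: "x \<ge> 1"
    and h: "\<And>n m. (\<And>j. j \<in> {1..k} \<Longrightarrow> n j = m j) \<Longrightarrow> h n = h m"
  shows "(LINT \<omega>|M. h (\<lambda>j. X j \<omega>)) = 1 / real x ^ k * (\<Sum>n\<in>{1..k} \<rightarrow>\<^sub>E {1..x}. h n)"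
proof -
  interpret prob_space M
    using iid by (simp add: iid_uniform_def)
  have indep: "indep_vars (\<lambda>_. count_space UNIV) X {1..k}"
    and distr: "distr M (count_space UNIV) (X j) = measure_pmf (pmf_of_set {1..x})" if "j \<in> {1..k}" for j
    using iid that by (auto simp: iid_uniform_def)
  have X: "X j \<in> measurable M (count_space UNIV)" if "j \<in> {1..k}" for j
    using iid that unfolding iid_uniform_def indep_vars_def by auto
  have prob_X: "prob (X j -` B \<inter> space M) = measure (measure_pmf (pmf_of_set {1..x})) B" if "j \<in> {1..k}" for j B
    using distr [OF that] X [OF that] measure_distr [of "X j" M "count_space UNIV" B] by simp
  have fin: "finite ({1..k} \<rightarrow>\<^sub>E {1..x})"
    by (intro finite_PiE) auto
  define B where "B n = (\<Inter>j\<in>{1..k}. X j -` {n j} \<inter> space M)" for n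
  have B [measurable]: "B n \<in> sets M" for n
    unfolding B_def using k X by (intro sets.finite_INT) (auto intro!: measurable_sets)
  have prob_B: "prob (B n) = 1 / real x ^ k" if n: "n \<in> {1..k} \<rightarrow>\<^sub>E {1..x}" for n
  proof -
    have "prob (B n) = (\<Prod>j\<in>{1..k}. prob (X j -` {n j} \<inter> space M))"
      unfolding B_def using k iid by (intro indep_varsD_finite [where M' = "\<lambda>_. count_space UNIV"]) (auto simp: iid_uniform_def)
    also have "\<dots> = (\<Prod>j\<in>{1..k}. 1 / real x)"
    proof (rule prod.cong [OF refl])
      fix j assume j: "j \<in> {1..k}"
      then have "n j \<in> {1..x}"
        using n by (auto simp: PiE_iff)
      then show "prob (X j -` {n j} \<inter> space M) = 1 / real x"
        using x by (subst prob_X [OF j]) (simp add: measure_pmf_single pmf_of_set)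
    qed
    finally show ?thesis
      by (simp add: power_one_over)
  qed
  have "AE \<omega> in M. X j \<omega> \<in> {1..x}" if j: "j \<in> {1..k}" for j
  proof -
    have "prob (X j -` {1..x} \<inter> space M) = 1"
      using x by (subst prob_X [OF j]) (simp add: measure_pmf_of_set)
    moreover have "X j -` {1..x} \<inter> space M \<in> events"
      using X [OF j] by (rule measurable_sets) simp
    ultimately show ?thesis
      using prob_eq_1 [of "X j -` {1..x} \<inter> space M"] by (auto elim!: AE_mp)
  qed
  then have "AE \<omega> in M. \<forall>j\<in>{1..k}. X j \<omega> \<in> {1..x}"
    by (intro AE_finite_allI) auto
  then have eq: "AE \<omega> in M. h (\<lambda>j. X j \<omega>) = (\<Sum>n\<in>{1..k} \<rightarrow>\<^sub>E {1..x}. h n * indicator (B n) \<omega>)"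
  proof (rule AE_mp, intro AE_I2 impI)
    fix \<omega> assume \<omega>: "\<omega> \<in> space M" and range: "\<forall>j\<in>{1..k}. X j \<omega> \<in> {1..x}"
    define m where "m = (\<lambda>j\<in>{1..k}. X j \<omega>)"
    have m: "m \<in> {1..k} \<rightarrow>\<^sub>E {1..x}"
      using range by (auto simp: m_def)
    have "\<omega> \<in> B n \<longleftrightarrow> n = m" if n: "n \<in> {1..k} \<rightarrow>\<^sub>E {1..x}" for n
    proof
      assume "\<omega> \<in> B n"
      then show "n = m"
        using n m k by (intro PiE_ext [OF n m]) (auto simp: B_def m_def)
    next
      assume "n = m"
      then show "\<omega> \<in> B n"
        using \<omega> k by (auto simp: B_def m_def)
    qed
    then have "(\<Sum>n\<in>{1..k} \<rightarrow>\<^sub>E {1..x}. h n * indicator (B n) \<omega>) =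
        (\<Sum>n\<in>{1..k} \<rightarrow>\<^sub>E {1..x}. if n = m then h n else 0)"
      by (intro sum.cong refl) (simp add: indicator_def)
    also have "\<dots> = h m"
      using m fin by simp
    also have "\<dots> = h (\<lambda>j. X j \<omega>)"
      by (rule h) (simp add: m_def)
    finally show "h (\<lambda>j. X j \<omega>) = (\<Sum>n\<in>{1..k} \<rightarrow>\<^sub>E {1..x}. h n * indicator (B n) \<omega>)"
      by simp
  qed
  have "(\<lambda>\<omega>. h (\<lambda>j\<in>{1..k}. X j \<omega>)) \<in> borel_measurable M"
  proof (rule measurable_compose [where f = "\<lambda>\<omega>. \<lambda>j\<in>{1..k}. X j \<omega>" and g = h])
    show "(\<lambda>\<omega>. \<lambda>j\<in>{1..k}. X j \<omega>) \<in> measurable M (PiM {1..k} (\<lambda>_. count_space UNIV))"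
      using X by (intro measurable_restrict)
    show "h \<in> borel_measurable (PiM {1..k} (\<lambda>_. count_space (UNIV :: nat set)))"
      by (subst count_space_PiM_finite) auto
  qed
  moreover have "h (\<lambda>j\<in>{1..k}. X j \<omega>) = h (\<lambda>j. X j \<omega>)" for \<omega>
    by (rule h) simp
  ultimately have "(\<lambda>\<omega>. h (\<lambda>j. X j \<omega>)) \<in> borel_measurable M"
    by simp
  then have "(LINT \<omega>|M. h (\<lambda>j. X j \<omega>)) = (LINT \<omega>|M. (\<Sum>n\<in>{1..k} \<rightarrow>\<^sub>E {1..x}. h n * indicator (B n) \<omega>))"
    using eq by (intro integral_cong_AE) auto
  also have "\<dots> = (\<Sum>n\<in>{1..k} \<rightarrow>\<^sub>E {1..x}. h n * prob (B n))"
    by (subst Bochner_Integration.integral_sum)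
       (auto intro!: integrable_mult_right integrable_real_indicator simp: less_top [symmetric])
  also have "\<dots> = 1 / real x ^ k * (\<Sum>n\<in>{1..k} \<rightarrow>\<^sub>E {1..x}. h n)"
    by (simp add: prob_B sum_divide_distrib)
  finally show ?thesis .
qed

text \<open>This makes \<open>1 - 1 / (2 * ln x)\<close> nonnegative. The factor 2 is there because
  \<open>ln 2 < 1\<close>: from \<open>x = 2\<close> on, powers of \<open>2 * ln x\<close> do not
  decrease with the exponent.\<close>

lemma ln_ge_half:
  assumes "x \<ge> 2"
  shows "1 \<le> 2 * ln (real x)"
proof -
  have "ln 2 \<le> ln (real x)"
    using assms by (intro ln_mono) auto
  then show ?thesis
    using ln2_ge_two_thirds by linarith
qed

text \<open>Here \<open>N\<close> tends to infinity with \<open>x\<close> fixed; the estimates are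
  uniform in \<open>N\<close> because \<open>B\<close> bounds all Euler products. \<open>C\<close>
  is chosen before \<open>s\<close> and \<open>B\<close>, so these may depend on
  \<open>x\<close>.\<close>

lemma weighted_avg_C_const_bound:
  assumes k: "k \<ge> 1" and r: "r > -1" and \<rho>: "\<rho> > -1"
  shows "\<exists>C>0. \<forall>x s B. x \<ge> 1 \<longrightarrow> 0 \<le> s \<longrightarrow> s \<le> 1 \<longrightarrow> s \<le> 1 + \<rho> \<longrightarrow>
    (\<forall>i\<in>{1..k}. \<forall>N. (\<Prod>p\<in>primes_le N. local_series r {1..k} N i s p) \<le> B) \<longrightarrow>
    \<bar>weighted_avg r \<rho> {1..k} x - C_const r k / (\<rho> + 1) ^ k\<bar> \<le> C * real x powr (- s) * B"
proof -
  obtain C where C: "C > 0"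
    and approx: "\<And>x N s. x \<ge> 1 \<Longrightarrow> x \<le> N \<Longrightarrow> 0 \<le> s \<Longrightarrow> s \<le> 1 \<Longrightarrow> s \<le> 1 + \<rho> \<Longrightarrow>
      \<bar>weighted_avg r \<rho> {1..k} x - truncated_const r {1..k} N / (\<rho> + 1) ^ k\<bar> \<le>
      C * real x powr (- s) * (\<Sum>i\<in>{1..k}. \<Prod>p\<in>primes_le N. local_series r {1..k} N i s p)"
    using weighted_avg_approx [of "{1..k}" \<rho> r] k \<rho> by auto
  show ?thesis
  proof (intro exI conjI allI impI)
    fix x :: nat and s B :: real
    assume x: "x \<ge> 1" "0 \<le> s" "s \<le> 1" "s \<le> 1 + \<rho>"
      and B: "\<forall>i\<in>{1..k}. \<forall>N. (\<Prod>p\<in>primes_le N. local_series r {1..k} N i s p) \<le> B"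
    have "(\<lambda>N. \<bar>weighted_avg r \<rho> {1..k} x - truncated_const r {1..k} N / (\<rho> + 1) ^ k\<bar>) \<longlonglongrightarrow>
        \<bar>weighted_avg r \<rho> {1..k} x - C_const r k / (\<rho> + 1) ^ k\<bar>"
      using truncated_const_tendsto [OF k r] \<rho> unfolding C_const_eq [OF k r]
      by (intro tendsto_intros) auto
    moreover have "\<bar>weighted_avg r \<rho> {1..k} x - truncated_const r {1..k} N / (\<rho> + 1) ^ k\<bar> \<le>
        C * real k * real x powr (- s) * B" if "N \<ge> x" for N
    proof -
      have "(\<Sum>i\<in>{1..k}. \<Prod>p\<in>primes_le N. local_series r {1..k} N i s p) \<le> (\<Sum>i\<in>{1..k}. B)"
        using B by (intro sum_mono) auto
      then have "C * real x powr (- s) * (\<Sum>i\<in>{1..k}. \<Prod>p\<in>primes_le N. local_series r {1..k} N i s p) \<le>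
          C * real x powr (- s) * (\<Sum>i\<in>{1..k}. B)"
        using C by (intro mult_left_mono) auto
      with approx [OF x(1) that x(2-4)] show ?thesis
        by (simp add: mult_ac)
    qed
    ultimately show "\<bar>weighted_avg r \<rho> {1..k} x - C_const r k / (\<rho> + 1) ^ k\<bar> \<le>
        C * real k * real x powr (- s) * B"
      by (intro tendsto_upperbound [where F = sequentially]) (auto simp: eventually_sequentially)
  qed (use C k in auto)
qed

text \<open>The choice \<open>s = 1 - 1 / (2 ln x)\<close> keeps \<open>x powr (- s)\<close> comparable to \<open>1 / x\<close>, while the Euler
  products grow like \<open>(1 / (1 - s)) ^ (k - 1)\<close>.\<close>

lemma weighted_avg_error_pos:
  assumes k: "k \<ge> 1" and r: "r > 0" and \<rho>: "\<rho> \<ge> 0"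
  shows "\<exists>C\<ge>0. \<forall>x\<ge>2. \<bar>weighted_avg r \<rho> {1..k} x - C_const r k / (\<rho> + 1) ^ k\<bar> \<le>
    C * (real x powr (- 1) * ln (real x) ^ (k - 1))"
proof -
  obtain C where C: "C > 0"
    and bound: "\<And>x s B. x \<ge> 1 \<Longrightarrow> 0 \<le> s \<Longrightarrow> s \<le> 1 \<Longrightarrow> s \<le> 1 + \<rho> \<Longrightarrow>
      (\<And>i N. i \<in> {1..k} \<Longrightarrow> (\<Prod>p\<in>primes_le N. local_series r {1..k} N i s p) \<le> B) \<Longrightarrow>
      \<bar>weighted_avg r \<rho> {1..k} x - C_const r k / (\<rho> + 1) ^ k\<bar> \<le> C * real x powr (- s) * B"
    using weighted_avg_C_const_bound [of k r \<rho>] k r \<rho> by auto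
  have "\<exists>D>0. \<forall>s N. 0 \<le> s \<longrightarrow> s < 1 \<longrightarrow>
      (\<Prod>p\<in>primes_le N. local_series r {1..k} N i s p) \<le> D * (1 + 1 / (1 - s)) ^ (k - 1)"
    if "i \<in> {1..k}" for i
    using prod_local_series_le_nonneg [of "{1..k}" i r] that r by simp
  then obtain D where D: "\<And>i. i \<in> {1..k} \<Longrightarrow> D i > 0"
    and prod_le: "\<And>i s N. i \<in> {1..k} \<Longrightarrow> 0 \<le> s \<Longrightarrow> s < 1 \<Longrightarrow>
      (\<Prod>p\<in>primes_le N. local_series r {1..k} N i s p) \<le> D i * (1 + 1 / (1 - s)) ^ (k - 1)"
    by metis
  define D' where "D' = (\<Sum>i\<in>{1..k}. D i)"
  have D': "D i \<le> D'" if "i \<in> {1..k}" for i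
    unfolding D'_def using that D by (intro member_le_sum) (auto intro: less_imp_le)
  have "D' \<ge> 0"
    unfolding D'_def using D by (intro sum_nonneg) (auto intro: less_imp_le)
  show ?thesis
  proof (intro exI conjI allI impI)
    show "0 \<le> C * exp (1 / 2) * D' * 4 ^ (k - 1)"
      using C \<open>D' \<ge> 0\<close> by simp
    fix x :: nat assume x: "x \<ge> 2"
    define l where "l = ln (real x)"
    define s where "s = 1 - 1 / (2 * l)"
    have l: "1 \<le> 2 * l"
      unfolding l_def by (rule ln_ge_half [OF x])
    then have s: "0 \<le> s" "s < 1" "1 / (1 - s) = 2 * l"
      by (auto simp: s_def field_simps)
    have "\<bar>weighted_avg r \<rho> {1..k} x - C_const r k / (\<rho> + 1) ^ k\<bar> \<le>
        C * real x powr (- s) * (D' * (1 + 1 / (1 - s)) ^ (k - 1))"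
    proof (rule bound)
      fix i N assume i: "i \<in> {1..k}"
      have "D i * (1 + 1 / (1 - s)) ^ (k - 1) \<le> D' * (1 + 1 / (1 - s)) ^ (k - 1)"
        using D' [OF i] s(3) l by (intro mult_right_mono zero_le_power) auto
      then show "(\<Prod>p\<in>primes_le N. local_series r {1..k} N i s p) \<le> D' * (1 + 1 / (1 - s)) ^ (k - 1)"
        using prod_le [OF i s(1,2), of N] by linarith
    qed (use x s \<rho> in auto)
    \<comment> \<open>\<open>x powr (1 / (2 * l))\<close> is \<open>exp (1 / 2)\<close>, as
      \<open>l\<close> is the logarithm of \<open>x\<close>.\<close>
    also have "real x powr (- s) = real x powr (- 1) * exp (1 / 2)"
    proof -
      have "- s * l = - l + 1 / 2"
        using l by (simp add: s_def field_simps)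
      then show ?thesis
        using x by (simp add: powr_def l_def exp_add [symmetric])
    qed
    \<comment> \<open>\<open>1 + 2 * l \<le> 4 * l\<close> because
      \<open>1 \<le> 2 * l\<close>.\<close>
    also have "C * (real x powr (- 1) * exp (1 / 2)) * (D' * (1 + 1 / (1 - s)) ^ (k - 1)) \<le>
        C * (real x powr (- 1) * exp (1 / 2)) * (D' * (4 * l) ^ (k - 1))"
      using C \<open>D' \<ge> 0\<close> l s(3) by (intro mult_left_mono power_mono) auto
    finally show "\<bar>weighted_avg r \<rho> {1..k} x - C_const r k / (\<rho> + 1) ^ k\<bar> \<le>
        C * exp (1 / 2) * D' * 4 ^ (k - 1) * (real x powr (- 1) * ln (real x) ^ (k - 1))"
      by (simp add: l_def power_mult_distrib mult_ac)
  qed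
qed

text \<open>The fixed choice \<open>s = (1 + r) / 2\<close> keeps the Euler products bounded, so no
  logarithm appears. It is admissible: \<open>r \<le> 0\<close> gives \<open>s \<le> 1\<close>, and
  \<open>\<rho> \<ge> r\<close> gives \<open>s \<le> 1 + \<rho>\<close>.\<close>

lemma weighted_avg_error_nonpos:
  assumes k: "k \<ge> 1" and r: "-1 < r" "r \<le> 0" and \<rho>: "\<rho> \<ge> r"
  shows "\<exists>C\<ge>0. \<forall>x\<ge>2. \<bar>weighted_avg r \<rho> {1..k} x - C_const r k / (\<rho> + 1) ^ k\<bar> \<le>
    C * real x powr (- (r + 1) / 2)"
proof -
  obtain C where C: "C > 0"
    and bound: "\<And>x s B. x \<ge> 1 \<Longrightarrow> 0 \<le> s \<Longrightarrow> s \<le> 1 \<Longrightarrow> s \<le> 1 + \<rho> \<Longrightarrow>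
      (\<And>i N. i \<in> {1..k} \<Longrightarrow> (\<Prod>p\<in>primes_le N. local_series r {1..k} N i s p) \<le> B) \<Longrightarrow>
      \<bar>weighted_avg r \<rho> {1..k} x - C_const r k / (\<rho> + 1) ^ k\<bar> \<le> C * real x powr (- s) * B"
    using weighted_avg_C_const_bound [of k r \<rho>] k r \<rho> by auto
  have "\<exists>D>0. \<forall>N. (\<Prod>p\<in>primes_le N. local_series r {1..k} N i ((1 + r) / 2) p) \<le> D"
    if "i \<in> {1..k}" for i
    using prod_local_series_le_nonpos [of "{1..k}" i r] that r by simp
  then obtain D where D: "\<And>i. i \<in> {1..k} \<Longrightarrow> D i > 0"
    and prod_le: "\<And>i N. i \<in> {1..k} \<Longrightarrow>
      (\<Prod>p\<in>primes_le N. local_series r {1..k} N i ((1 + r) / 2) p) \<le> D i"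
    by metis
  define D' where "D' = (\<Sum>i\<in>{1..k}. D i)"
  have D': "D i \<le> D'" if "i \<in> {1..k}" for i
    unfolding D'_def using that D by (intro member_le_sum) (auto intro: less_imp_le)
  have "D' \<ge> 0"
    unfolding D'_def using D by (intro sum_nonneg) (auto intro: less_imp_le)
  show ?thesis
  proof (intro exI conjI allI impI)
    show "0 \<le> C * D'"
      using C \<open>D' \<ge> 0\<close> by simp
    fix x :: nat assume x: "x \<ge> 2"
    have "\<bar>weighted_avg r \<rho> {1..k} x - C_const r k / (\<rho> + 1) ^ k\<bar> \<le> C * real x powr (- ((1 + r) / 2)) * D'"
      using x r \<rho> order_trans [OF prod_le D'] by (intro bound) auto
    also have "- ((1 + r) / 2) = - (r + 1) / 2"
      by (metis add.commute minus_divide_left)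
    finally show "\<bar>weighted_avg r \<rho> {1..k} x - C_const r k / (\<rho> + 1) ^ k\<bar> \<le> C * D' * real x powr (- (r + 1) / 2)"
      by (simp add: mult_ac)
  qed
qed

lemma ln_power_le:
  assumes "x \<ge> 2" "m \<le> n"
  shows "ln (real x) ^ m \<le> 2 ^ n * ln (real x) ^ n"
proof -
  have l: "1 \<le> 2 * ln (real x)"
    by (rule ln_ge_half [OF assms(1)])
  have "ln (real x) ^ m \<le> (2 * ln (real x)) ^ m"
    using l by (intro power_mono) auto
  also have "\<dots> \<le> (2 * ln (real x)) ^ n"
    by (rule power_increasing [OF assms(2) l])
  finally show ?thesis
    by (simp add: power_mult_distrib)
qed

text \<open>For \<open>r > 0\<close> the bound of order \<open>x powr (- 1)\<close> is at least as
  strong, since \<open>(r + 1) / 2 \<le> 1\<close>. For \<open>r \<le> 0\<close> the power of the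
  logarithm is inserted at the price of \<open>2 ^ n\<close>, since \<open>ln x\<close> may be below
  1. The lower bound \<open>min r 0\<close> admits both \<open>\<rho> = r\<close> and
  \<open>\<rho> = 0\<close>.\<close>

lemma weighted_avg_error_le_1:
  assumes k: "k \<ge> 1" and r: "-1 < r" "r \<le> 1" and \<rho>: "\<rho> \<ge> min r 0" and n: "n \<ge> k - 1"
  shows "\<exists>C\<ge>0. \<forall>x\<ge>2. \<bar>weighted_avg r \<rho> {1..k} x - C_const r k / (\<rho> + 1) ^ k\<bar> \<le>
    C * (real x powr (- (r + 1) / 2) * ln (real x) ^ n)"
proof (cases "r > 0")
  case True
  then obtain C where C: "C \<ge> 0" and bound: "\<And>x. x \<ge> 2 \<Longrightarrow>
      \<bar>weighted_avg r \<rho> {1..k} x - C_const r k / (\<rho> + 1) ^ k\<bar> \<le> C * (real x powr (- 1) * ln (real x) ^ (k - 1))"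
    using weighted_avg_error_pos [OF k True, of \<rho>] \<rho> by auto
  show ?thesis
  proof (intro exI conjI allI impI)
    fix x :: nat assume x: "x \<ge> 2"
    have "real x powr (- 1) * ln (real x) ^ (k - 1) \<le>
        real x powr (- (r + 1) / 2) * (2 ^ n * ln (real x) ^ n)"
      using x r ln_power_le [OF x n] by (intro mult_mono powr_mono) auto
    with bound [OF x] C show "\<bar>weighted_avg r \<rho> {1..k} x - C_const r k / (\<rho> + 1) ^ k\<bar> \<le>
        C * 2 ^ n * (real x powr (- (r + 1) / 2) * ln (real x) ^ n)"
      using mult_left_mono [of "real x powr (- 1) * ln (real x) ^ (k - 1)"
        "real x powr (- (r + 1) / 2) * (2 ^ n * ln (real x) ^ n)" C] by (simp add: mult_ac)
  qed (use C in auto)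
next
  case False
  then obtain C where C: "C \<ge> 0" and bound: "\<And>x. x \<ge> 2 \<Longrightarrow>
      \<bar>weighted_avg r \<rho> {1..k} x - C_const r k / (\<rho> + 1) ^ k\<bar> \<le> C * real x powr (- (r + 1) / 2)"
    using weighted_avg_error_nonpos [OF k r(1), of \<rho>] \<rho> by auto
  show ?thesis
  proof (intro exI conjI allI impI)
    fix x :: nat assume x: "x \<ge> 2"
    have "C * real x powr (- (r + 1) / 2) * 1 \<le> C * real x powr (- (r + 1) / 2) * (2 ^ n * ln (real x) ^ n)"
      using C ln_power_le [OF x, of 0 n] by (intro mult_left_mono) auto
    with bound [OF x] show "\<bar>weighted_avg r \<rho> {1..k} x - C_const r k / (\<rho> + 1) ^ k\<bar> \<le>
        C * 2 ^ n * (real x powr (- (r + 1) / 2) * ln (real x) ^ n)"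
      by (simp add: mult_ac)
  qed (use C in auto)
qed

text \<open>Yields \<open>k - 1 \<le> 2 ^ k - k - 1\<close>, so the logarithmic exponent for
  \<open>r \<le> 1\<close> is at least \<open>k - 1\<close>.\<close>

lemma two_mult_le_two_power: "k \<ge> 1 \<Longrightarrow> 2 * k \<le> 2 ^ (k :: nat)"
  by (induction k rule: dec_induct) auto

theorem theorem1p2:
  fixes k :: nat and r :: real
  assumes "k \<ge> 2" and "r > -1"
  shows "summable (\<lambda>n. C_term r k (Suc n)) \<and>
    (\<forall>x\<ge>2. \<forall>(M :: 'a measure) X. iid_uniform M k x X \<longrightarrow>
       (LINT \<omega>|M. real (LCM j\<in>{1..k}. X j \<omega>) powr r / real x powr (real k * r)) = lcm_avg r k x \<and>
       (LINT \<omega>|M. real (LCM j\<in>{1..k}. X j \<omega>) powr r / real (\<Prod>j\<in>{1..k}. X j \<omega>) powr r)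
         = lcm_ratio_avg r k x) \<and>
    (\<exists>E E' :: nat \<Rightarrow> real.
       (\<forall>x\<ge>2. lcm_avg r k x = C_const r k / (r + 1) ^ k + E x \<and>
               lcm_ratio_avg r k x = C_const r k + E' x) \<and>
       (r \<le> 1 \<longrightarrow> (\<exists>K. \<forall>x\<ge>2. \<forall>e\<in>{E x, E' x}.
          \<bar>e\<bar> \<le> K * (real x powr (- (r + 1) / 2)
                    * ln (real x) ^ max (2 ^ k - k - 1) (2 * k\<^sup>2 - k - 2)))) \<and>
       (r > 1 \<longrightarrow> (\<exists>K. \<forall>x\<ge>2. \<forall>e\<in>{E x, E' x}.
          \<bar>e\<bar> \<le> K * (real x powr (- 1) * ln (real x) ^ (k - 1)))))"
proof -
  have k: "k \<ge> 1"
    using assms by simp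
  \<comment> \<open>With the errors defined as differences the two decompositions are immediate, and
    only the bounds carry content.\<close>
  define E where "E x = lcm_avg r k x - C_const r k / (r + 1) ^ k" for x
  define E' where "E' x = lcm_ratio_avg r k x - C_const r k" for x
  define n where "n = max (2 ^ k - k - 1) (2 * k\<^sup>2 - k - 2)"
  have n: "k - 1 \<le> n"
    using two_mult_le_two_power [OF k] by (simp add: n_def)
  have expectations:
    "(LINT \<omega>|M. real (LCM j\<in>{1..k}. X j \<omega>) powr r / real x powr (real k * r)) = lcm_avg r k x \<and>
     (LINT \<omega>|M. real (LCM j\<in>{1..k}. X j \<omega>) powr r / real (\<Prod>j\<in>{1..k}. X j \<omega>) powr r) = lcm_ratio_avg r k x"
    if x: "x \<ge> 2" and iid: "iid_uniform M k x X" for x and M :: "'a measure" and X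
  proof
    have "(LINT \<omega>|M. real (LCM j\<in>{1..k}. X j \<omega>) powr r / real x powr (real k * r)) =
        1 / real x ^ k * (\<Sum>n\<in>{1..k} \<rightarrow>\<^sub>E {1..x}. real (LCM j\<in>{1..k}. n j) powr r / real x powr (real k * r))"
      using x by (intro iid_uniform_expectation [OF iid k]) (auto cong: image_cong_simp)
    also have "\<dots> = lcm_avg r k x"
      using x by (simp add: lcm_avg_def powr_divide powr_powr powr_realpow [symmetric])
    finally show "(LINT \<omega>|M. real (LCM j\<in>{1..k}. X j \<omega>) powr r / real x powr (real k * r)) = lcm_avg r k x" .
    have "(LINT \<omega>|M. real (LCM j\<in>{1..k}. X j \<omega>) powr r / real (\<Prod>j\<in>{1..k}. X j \<omega>) powr r) =
        1 / real x ^ k * (\<Sum>n\<in>{1..k} \<rightarrow>\<^sub>E {1..x}. real (LCM j\<in>{1..k}. n j) powr r / real (\<Prod>j\<in>{1..k}. n j) powr r)"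
      using x by (intro iid_uniform_expectation [OF iid k]) (auto cong: image_cong_simp prod.cong_simp)
    also have "\<dots> = lcm_ratio_avg r k x"
      by (simp add: lcm_ratio_avg_def powr_divide prod_nonneg)
    finally show "(LINT \<omega>|M. real (LCM j\<in>{1..k}. X j \<omega>) powr r / real (\<Prod>j\<in>{1..k}. X j \<omega>) powr r) =
        lcm_ratio_avg r k x" .
  qed
  \<comment> \<open>The form \<open>(0 + 1) ^ k\<close> matches \<open>(\<rho> + 1) ^ k\<close> at
    \<open>\<rho> = 0\<close>.\<close>
  have E: "E x = weighted_avg r r {1..k} x - C_const r k / (r + 1) ^ k"
    and E': "E' x = weighted_avg r 0 {1..k} x - C_const r k / (0 + 1) ^ k" if "x \<ge> 2" for x
    using that k by (auto simp: E_def E'_def lcm_avg_eq lcm_ratio_avg_eq)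
  \<comment> \<open>One constant has to serve both errors; since \<open>f\<close> is nonnegative,
    the sum of the two constants will do.\<close>
  have combine: "\<exists>K. \<forall>x\<ge>2. \<forall>e\<in>{E x, E' x}. \<bar>e\<bar> \<le> K * f x"
    if f: "\<And>x. x \<ge> 2 \<Longrightarrow> f x \<ge> 0" and bounds: "\<exists>C\<ge>0. \<forall>x\<ge>2. \<bar>E x\<bar> \<le> C * f x" "\<exists>C\<ge>0. \<forall>x\<ge>2. \<bar>E' x\<bar> \<le> C * f x"
    for f :: "nat \<Rightarrow> real"
  proof -
    obtain C where C: "C \<ge> 0" "\<And>x. x \<ge> 2 \<Longrightarrow> \<bar>E x\<bar> \<le> C * f x"
      using bounds(1) by blast
    obtain C' where C': "C' \<ge> 0" "\<And>x. x \<ge> 2 \<Longrightarrow> \<bar>E' x\<bar> \<le> C' * f x"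
      using bounds(2) by blast
    have "\<bar>e\<bar> \<le> (C + C') * f x" if "x \<ge> 2" "e \<in> {E x, E' x}" for x e
      using that C(2) [of x] C'(2) [of x] mult_nonneg_nonneg [OF C(1) f [of x]]
        mult_nonneg_nonneg [OF C'(1) f [of x]]
      by (auto simp: distrib_right)
    then show ?thesis
      by blast
  qed
  have bound_le_1: "\<exists>K. \<forall>x\<ge>2. \<forall>e\<in>{E x, E' x}.
      \<bar>e\<bar> \<le> K * (real x powr (- (r + 1) / 2) * ln (real x) ^ n)" if "r \<le> 1"
    using weighted_avg_error_le_1 [OF k assms(2) that _ n, of r]
      weighted_avg_error_le_1 [OF k assms(2) that _ n, of 0]
    by (intro combine) (auto simp: E E')
  have bound_gt_1: "\<exists>K. \<forall>x\<ge>2. \<forall>e\<in>{E x, E' x}.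
      \<bar>e\<bar> \<le> K * (real x powr (- 1) * ln (real x) ^ (k - 1))" if "r > 1"
    using weighted_avg_error_pos [OF k, of r r] weighted_avg_error_pos [OF k, of r 0] that
    by (intro combine) (auto simp: E E')
  have decomposition: "\<forall>x\<ge>2. lcm_avg r k x = C_const r k / (r + 1) ^ k + E x \<and>
      lcm_ratio_avg r k x = C_const r k + E' x"
    by (simp add: E_def E'_def)
  show ?thesis
  proof (intro conjI, goal_cases)
    case 1
    show ?case
      by (rule summable_C_term [OF k assms(2)])
  next
    case 2
    show ?case
      using expectations by blast
  next
    case 3
    show ?case
      using decomposition bound_le_1 bound_gt_1 unfolding n_def by blast
  qed
qed

end
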